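(* Let $X$ be a real hyperelliptic curve of genus $g\ge 1$ with $n(X)\ge 1$ real connected components, given by the affine equation $$y^2=f(x)=x\prod_{i=1}^{2n(X)-2}(x-p_i)\prod_{j=1}^{g+1-n(X)}(x-q_j)(x-\overline{q_j}),$$ where the $p_i\in\mathbb{R}^*$ and $q_j\in\mathbb{C}\setminus\mathbb{R}$ are such that all roots $0,p_i,q_j,\overline{q_j}$ of $f$ are distinct. When $1\le k\le g$, the inflection divisor $\mathrm{Inf}(|\mathcal{L}_{\mathbb{R}}(kD)|)$ is $\binom{k+1}{2}$ times the ramification divisor $R_\pi$ of $\pi$. In particular, the linear series $|\mathcal{L}_{\mathbb{R}}(kD)|$ has $k(k+1)\,n(X)$ real inflection points (counted with inflectionary weight).
   Context: $X$ denotes the smooth projective complex curve compactifying the affine curve $y^2=f(x)$ by one point $\infty$, with the antiholomorphic involution $\sigma_X$ extending $(x,y)\mapsto(\overline{x},\overline{y})$. $X(\mathbb{R})$ is the fixed locus of $\sigma_X$ and $n(X)$ is its number of connected components. The hyperelliptic structure map is $\pi:X\to\mathbb{P}^1$, $(x,y)\mapsto x$, with ramification divisor $R_\pi$, and $D=2\cdot\infty=\pi^*(\infty)$. $\mathcal{L}_{\mathbb{R}}(kD)$ is the real line bundle defined by $kD$ and $|\mathcal{L}_{\mathbb{R}}(kD)|$ is the complete real linear series given by the space of all real sections $H^0(X_{\mathbb{R}},\mathcal{L}_{\mathbb{R}}(kD))$. For a linear series with section space $V$ of dimension $r+1$ and a point $p\in X$, let $o_0<\dots<o_r$ be the vanishing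 orders at $p$ of the nonzero sections in (the complexification of) $V$. The inflectionary weight is $|p|=\sum_{i=0}^r(o_i-i)$, and the inflection divisor is $\mathrm{Inf}=\sum_{p}|p|\cdot p$. The number of real inflection points is the degree of the real part $\sum_{p\in X(\mathbb{R})}|p|\cdot p$ of the inflection divisor. *)

theory Defs
  imports
    "HOL-Complex_Analysis.Complex_Analysis"
    "HOL-Computational_Algebra.Computational_Algebra"
    "HOL-Computational_Algebra.Field_as_Ring"
begin

text \<open>
  Throughout, \<open>f\<close> is a complex polynomial; the definitions describe the smooth projective curve
  of \<open>y^2 = f x\<close> when \<open>f\<close> is squarefree of odd degree, so that one point at infinity
  compactifies the affine curve. That point is \<open>None\<close>.
\<close>

type_synonym point = "(complex \<times> complex) option"
type_synonym divisor = "point \<Rightarrow> int"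

definition affine_curve :: "complex poly \<Rightarrow> (complex \<times> complex) set" where
  "affine_curve f = {(x, y). y ^ 2 = poly f x}"

definition curve :: "complex poly \<Rightarrow> point topology" where
  "curve f = Alexandroff_compactification (top_of_set (affine_curve f))"

definition sigma :: "point \<Rightarrow> point" where
  "sigma = map_option (\<lambda>(x, y). (cnj x, cnj y))"

definition real_points :: "complex poly \<Rightarrow> point set" where
  "real_points f = {P \<in> topspace (curve f). sigma P = P}"

definition num_real_components :: "complex poly \<Rightarrow> nat" where
  "num_real_components f = card (connected_components_of (subtopology (curve f) (real_points f)))"

text \<open>
  The complex structure. A local parametrization at \<open>P\<close> is the inverse of a holomorphic chart
  centred at \<open>P\<close>, restricted to a punctured disc: an injective map to the affine curve with
  meromorphic coordinates that tends to \<open>P\<close>. The values of \<open>u\<close> and \<open>v\<close> at \<open>0\<close> are irrelevant.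
\<close>

definition local_param ::
  "complex poly \<Rightarrow> point \<Rightarrow> (complex \<Rightarrow> complex) \<times> (complex \<Rightarrow> complex) \<Rightarrow> bool" where
  "local_param f P = (\<lambda>(u, v).
     u meromorphic_on {0} \<and> v meromorphic_on {0} \<and>
     (\<exists>r>0. inj_on (\<lambda>t. (u t, v t)) (ball 0 r - {0}) \<and>
            (\<forall>t \<in> ball 0 r - {0}. (u t, v t) \<in> affine_curve f)) \<and>
     limitin (curve f) (\<lambda>t. Some (u t, v t)) P (at 0))"

text \<open>
  The pair \<open>(a, b)\<close> of rational functions of \<open>x\<close> stands for the element \<open>a + b y\<close> of the function
  field \<open>\<complex>(x)[y] / (y^2 - f)\<close>. Only its \<open>\<complex>\<close>-vector space structure is needed; addition is
  componentwise.
\<close>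

type_synonym ratfun = "complex poly fract \<times> complex poly fract"

definition fract_eval :: "complex poly fract \<Rightarrow> complex \<Rightarrow> complex" where
  "fract_eval a x = (let (n, d) = quot_of_fract a in poly n x / poly d x)"

definition ratfun_eval :: "ratfun \<Rightarrow> complex \<Rightarrow> complex \<Rightarrow> complex" where
  "ratfun_eval = (\<lambda>(a, b) x y. fract_eval a x + fract_eval b x * y)"

definition ratfun_scale :: "complex \<Rightarrow> ratfun \<Rightarrow> ratfun" where
  "ratfun_scale c = (\<lambda>(a, b). (to_fract [:c:] * a, to_fract [:c:] * b))"

interpretation ratfun: vector_space ratfun_scale
proof
  have add: "to_fract [:a + b:] = to_fract [:a:] + to_fract [:b:]" for a b :: complex
    by (simp flip: to_fract_add)
  have mult: "to_fract [:a * b:] = to_fract [:a:] * to_fract [:b:]" for a b :: complex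
    by (simp flip: to_fract_mult)
  have one: "to_fract [:1::complex:] = 1"
    by (metis one_pCons to_fract_1)
  show "ratfun_scale a (x + y) = ratfun_scale a x + ratfun_scale a y" for a x y
    by (auto simp: ratfun_scale_def algebra_simps split: prod.splits)
  show "ratfun_scale (a + b) x = ratfun_scale a x + ratfun_scale b x" for a b x
    by (auto simp: ratfun_scale_def add algebra_simps split: prod.splits)
  show "ratfun_scale a (ratfun_scale b x) = ratfun_scale (a * b) x" for a b x
    by (auto simp: ratfun_scale_def mult split: prod.splits)
  show "ratfun_scale 1 x = x" for x
    by (auto simp: ratfun_scale_def one split: prod.splits)
qed

text \<open>
  Vanishing order of a nonzero rational function. It does not depend on the choice of local
  parametrization, and \<^const>\<open>zorder\<close> only looks at a punctured neighbourhood of \<open>0\<close>.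
\<close>

definition ord_at :: "complex poly \<Rightarrow> point \<Rightarrow> ratfun \<Rightarrow> int" where
  "ord_at f P h = (let (u, v) = (SOME uv. local_param f P uv)
     in zorder (\<lambda>t. ratfun_eval h (u t) (v t)) 0)"

text \<open>The order at \<open>P\<close> of the meromorphic differential \<open>h dx\<close>.\<close>

definition diff_ord_at :: "complex poly \<Rightarrow> point \<Rightarrow> ratfun \<Rightarrow> int" where
  "diff_ord_at f P h = (let (u, v) = (SOME uv. local_param f P uv)
     in zorder (\<lambda>t. ratfun_eval h (u t) (v t) * deriv u t) 0)"

text \<open>The dimension of the space of holomorphic differentials.\<close>

definition genus :: "complex poly \<Rightarrow> nat" where
  "genus f = ratfun.dim {h. h \<noteq> 0 \<longrightarrow> (\<forall>P \<in> topspace (curve f). diff_ord_at f P h \<ge> 0)}"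

text \<open>
  The line bundle of a divisor \<open>E\<close> has the space of global sections
  \<open>{h. h = 0 \<or> div h + E \<ge> 0}\<close>; as a section of it, \<open>h\<close> vanishes at \<open>P\<close> to order
  \<open>ord\<^sub>P h + E P\<close>. Real sections are those fixed by \<open>h \<mapsto> cnj \<circ> h \<circ> sigma\<close>, which conjugates the
  coefficients of \<open>a\<close> and \<open>b\<close> in \<open>a + b y\<close>.
\<close>

definition sections :: "complex poly \<Rightarrow> divisor \<Rightarrow> ratfun set" where
  "sections f E = {h. h \<noteq> 0 \<longrightarrow> (\<forall>P \<in> topspace (curve f). ord_at f P h + E P \<ge> 0)}"

definition fract_cnj :: "complex poly fract \<Rightarrow> complex poly fract" where
  "fract_cnj a = (let (n, d) = quot_of_fract a in Fract (map_poly cnj n) (map_poly cnj d))"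

definition ratfun_conj :: "ratfun \<Rightarrow> ratfun" where
  "ratfun_conj = (\<lambda>(a, b). (fract_cnj a, fract_cnj b))"

definition real_sections :: "complex poly \<Rightarrow> divisor \<Rightarrow> ratfun set" where
  "real_sections f E = {h \<in> sections f E. ratfun_conj h = h}"

text \<open>
  \<open>V\<close> is a space of real sections of the line bundle of \<open>E\<close>. Its complexification is
  its complex span, as the function field is the complexification of its real elements.
\<close>

definition vanishing_orders ::
  "complex poly \<Rightarrow> divisor \<Rightarrow> ratfun set \<Rightarrow> point \<Rightarrow> int set" where
  "vanishing_orders f E V P = {ord_at f P h + E P | h. h \<in> ratfun.span V \<and> h \<noteq> 0}"

definition inflectionary_weight ::
  "complex poly \<Rightarrow> divisor \<Rightarrow> ratfun set \<Rightarrow> point \<Rightarrow> int" where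
  "inflectionary_weight f E V P =
     (let os = sorted_list_of_set (vanishing_orders f E V P)
      in \<Sum>i<length os. os ! i - int i)"

text \<open>Divisors on the curve are extended by \<open>0\<close> to all values of type \<^typ>\<open>point\<close>.\<close>

definition inflection_divisor :: "complex poly \<Rightarrow> divisor \<Rightarrow> ratfun set \<Rightarrow> divisor" where
  "inflection_divisor f E V P =
     (if P \<in> topspace (curve f) then inflectionary_weight f E V P else 0)"

text \<open>\<open>ord\<^sub>P (\<pi>^* s)\<close>, where \<open>s\<close> is the coordinate \<open>x - x0\<close> or \<open>1 / x\<close> of the projective line
  at \<open>\<pi> P\<close>.\<close>

definition ramification_index :: "complex poly \<Rightarrow> point \<Rightarrow> int" where
  "ramification_index f P = (case P of
     Some (x0, y0) \<Rightarrow> ord_at f P (to_fract [:- x0, 1:], 0)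
   | None \<Rightarrow> ord_at f P (Fract 1 [:0, 1:], 0))"

definition ramification_divisor :: "complex poly \<Rightarrow> divisor" where
  "ramification_divisor f P =
     (if P \<in> topspace (curve f) then ramification_index f P - 1 else 0)"

definition div_D :: divisor where
  "div_D P = (if P = None then 2 else 0)"

text \<open>The degree of the part of \<open>E\<close> supported on \<open>S\<close>.\<close>

definition degree_on :: "point set \<Rightarrow> divisor \<Rightarrow> int" where
  "degree_on S E = (\<Sum>P \<in> {P \<in> S. E P \<noteq> 0}. E P)"

definition num_real_inflection_points ::
  "complex poly \<Rightarrow> divisor \<Rightarrow> ratfun set \<Rightarrow> int" where
  "num_real_inflection_points f E V = degree_on (real_points f) (inflection_divisor f E V)"

end

theory Submission
  imports Defs
begin

text \<open>
  The sections of \<open>k D\<close> are the polynomials of degree at most \<open>k\<close> in \<open>x\<close> (\<open>sections_kD\<close>): a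
  section is \<open>a(x) + b(x) y\<close>, the absence of poles at finite points makes \<open>a\<close> and \<open>b\<close>
  polynomials, and the pole of order \<open>2 g + 1 > 2 k\<close> of \<open>y\<close> at infinity excludes \<open>b \<noteq> 0\<close>. So the
  linear series is the pullback along \<open>\<pi>\<close> of the complete series of degree \<open>k\<close> on the projective
  line, where every point has the vanishing orders \<open>0, 1, \<dots>, k\<close>. Pulling back multiplies orders
  at \<open>P\<close> by the ramification index \<open>e\<close> of \<open>\<pi>\<close> at \<open>P\<close> (\<open>vanishing_orders_kD\<close>), so the weight of
  \<open>P\<close> is the sum of \<open>e i - i\<close> over \<open>i \<le> k\<close>, that is \<open>(e - 1)\<close> times \<open>k + 1\<close> choose \<open>2\<close>
  (\<open>inflectionary_weight_kD\<close>).

  The index \<open>e\<close> is \<open>2\<close> at the roots of \<open>f\<close> and at infinity, and \<open>1\<close> elsewhere. The real roots are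
  \<open>0\<close> and the \<open>2 n - 2\<close> numbers \<open>p i\<close>, so with infinity there are \<open>2 n\<close> real ramification points,
  and the count is \<open>2 n\<close> times \<open>k + 1\<close> choose \<open>2\<close>, which is \<open>k (k + 1) n\<close>.

  The analytic work lies in the orders. They are measured in local parametrizations of which only
  injectivity, meromorphy and convergence to the point are known. Near each point of the curve some
  function of the coordinates separates points: \<open>x\<close> where \<open>y \<noteq> 0\<close>, \<open>y\<close> over a root of \<open>f\<close>, and
  \<open>x ^ g / y\<close> at infinity. Along any parametrization this function is injective, hence of order \<open>1\<close>
  (\<open>injective_imp_has_order_1\<close>), and the equation of the curve then gives the orders of \<open>x\<close> and \<open>y\<close>.
  Parametrizations exist at every point (\<open>ex_local_param\<close>) by taking a square root or by inverting
  \<open>f\<close>, or its analogue at infinity, at \<open>t ^ 2\<close>.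
\<close>

section \<open>Orders of meromorphic germs at the origin\<close>

text \<open>
  The order is stated through the limit of \<open>w t / t powi m\<close>, so that products, quotients and sums
  of germs are treated by the limit laws. By \<open>has_order_imp_zorder\<close> it determines \<^const>\<open>zorder\<close>;
  the germ that vanishes identically near \<open>0\<close> has no order.
\<close>
definition has_order :: "(complex \<Rightarrow> complex) \<Rightarrow> int \<Rightarrow> bool" where
  "has_order w m \<longleftrightarrow>
     w meromorphic_on {0} \<and> (\<exists>c. c \<noteq> 0 \<and> (\<lambda>t. w t / t powi m) \<midarrow>0\<rightarrow> c)"

lemma has_order_meromorphic: "has_order w m \<Longrightarrow> w meromorphic_on {0}"
  by (simp add: has_order_def)

lemma eventually_at_0_nonzero: "eventually (\<lambda>t::complex. t \<noteq> 0) (at 0)"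
  by (simp add: eventually_at_filter)

lemma meromorphic_tendsto_extends:
  assumes "w meromorphic_on {0}" and "w \<midarrow>0\<rightarrow> c"
  obtains r where "r > 0" and "(\<lambda>t. if t = 0 then c else w t) holomorphic_on ball 0 r"
proof -
  have "(\<lambda>t. if t = 0 then c else w t) analytic_on {0}"
    using assms by (intro removable_singularity') (auto simp: meromorphic_at_iff)
  then show ?thesis
    using that by (auto simp: analytic_at_ball)
qed

text \<open>
  The quotient \<open>w t / t powi m\<close> is meromorphic with a finite limit, so it extends holomorphically to
  \<open>0\<close>; its value there is nonzero, which is the factorization that defines \<^const>\<open>zorder\<close>.
\<close>
lemma has_order_imp_zorder:
  assumes "has_order w m"
  shows "zorder w 0 = m"
proof -
  obtain c where c: "c \<noteq> 0" "(\<lambda>t. w t / t powi m) \<midarrow>0\<rightarrow> c" and w: "w meromorphic_on {0}"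
    using assms by (auto simp: has_order_def)
  have "(\<lambda>t. w t / t powi m) meromorphic_on {0}"
    by (intro meromorphic_intros w)
  then obtain r where r: "r > 0"
      "(\<lambda>t. if t = 0 then c else w t / t powi m) holomorphic_on ball 0 r" (is "?h holomorphic_on _")
    using meromorphic_tendsto_extends c(2) by blast
  show ?thesis
    by (rule zorder_eqI[where S = "ball 0 r" and g = ?h]) (use r c in auto)
qed

lemma has_order_cong:
  assumes "has_order w m" and "eventually (\<lambda>t. w t = z t) (at 0)"
  shows "has_order z m"
proof -
  obtain c where c: "c \<noteq> 0" "(\<lambda>t. w t / t powi m) \<midarrow>0\<rightarrow> c" and w: "w meromorphic_on {0}"
    using assms by (auto simp: has_order_def)
  have "z meromorphic_on {0}"
    using w meromorphic_on_cong[of "{0}" w z "{0}"] assms(2) by simp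
  moreover have "(\<lambda>t. z t / t powi m) \<midarrow>0\<rightarrow> c"
    by (rule Lim_transform_eventually[OF c(2)]) (use assms(2) in eventually_elim, simp)
  ultimately show ?thesis
    using c(1) by (auto simp: has_order_def)
qed

lemma has_order_0I:
  assumes "w meromorphic_on {0}" and "w \<midarrow>0\<rightarrow> c" and "c \<noteq> 0"
  shows "has_order w 0"
  using assms by (auto simp: has_order_def)

lemma has_order_mult:
  assumes "has_order w m" and "has_order z n"
  shows "has_order (\<lambda>t. w t * z t) (m + n)"
proof -
  obtain c where c: "c \<noteq> 0" "(\<lambda>t. w t / t powi m) \<midarrow>0\<rightarrow> c" and w: "w meromorphic_on {0}"
    using assms by (auto simp: has_order_def)
  obtain d where d: "d \<noteq> 0" "(\<lambda>t. z t / t powi n) \<midarrow>0\<rightarrow> d" and z: "z meromorphic_on {0}"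
    using assms by (auto simp: has_order_def)
  have "(\<lambda>t. w t * z t / t powi (m + n)) \<midarrow>0\<rightarrow> c * d"
    by (rule Lim_transform_eventually[OF tendsto_mult[OF c(2) d(2)]])
       (use eventually_at_0_nonzero in eventually_elim, simp add: power_int_add)
  then show ?thesis
    using c d w z unfolding has_order_def
    by (intro conjI exI[of _ "c * d"]) (auto intro!: meromorphic_intros)
qed

lemma has_order_inverse:
  assumes "has_order w m"
  shows "has_order (\<lambda>t. inverse (w t)) (- m)"
proof -
  obtain c where c: "c \<noteq> 0" "(\<lambda>t. w t / t powi m) \<midarrow>0\<rightarrow> c" and w: "w meromorphic_on {0}"
    using assms by (auto simp: has_order_def)
  have "(\<lambda>t. inverse (w t) / t powi (- m)) \<midarrow>0\<rightarrow> inverse c"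
    by (rule Lim_transform_eventually[OF tendsto_inverse[OF c(2) c(1)]])
       (use eventually_at_0_nonzero in eventually_elim, simp add: power_int_minus field_simps)
  then show ?thesis
    using c w unfolding has_order_def
    by (intro conjI exI[of _ "inverse c"]) (auto intro!: meromorphic_intros)
qed

lemma has_order_divide:
  assumes "has_order w m" and "has_order z n"
  shows "has_order (\<lambda>t. w t / z t) (m - n)"
  using has_order_mult[OF assms(1) has_order_inverse[OF assms(2)]] by (simp add: field_simps)

lemma has_order_power:
  assumes "has_order w m"
  shows "has_order (\<lambda>t. w t ^ n) (m * int n)"
proof (induction n)
  case 0
  show ?case by (auto intro!: has_order_0I[where c = 1] meromorphic_intros)
next
  case (Suc n)
  from has_order_mult[OF assms this] show ?case by (simp add: algebra_simps)
qed

lemma has_order_eventually_nonzero: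
  assumes "has_order w m"
  shows "eventually (\<lambda>t. w t \<noteq> 0) (at 0)"
proof -
  obtain c where c: "c \<noteq> 0" "(\<lambda>t. w t / t powi m) \<midarrow>0\<rightarrow> c"
    using assms by (auto simp: has_order_def)
  show ?thesis
    using tendsto_imp_eventually_ne[OF c(2) c(1)] by eventually_elim auto
qed

lemma has_order_pos_tendsto_0:
  assumes "has_order w m" and "m > 0"
  shows "w \<midarrow>0\<rightarrow> 0"
proof -
  obtain c where c: "c \<noteq> 0" "(\<lambda>t. w t / t powi m) \<midarrow>0\<rightarrow> c"
    using assms by (auto simp: has_order_def)
  have "((\<lambda>t::complex. t ^ nat m) \<longlongrightarrow> 0 ^ nat m) (at 0)"
    by (intro tendsto_intros)
  then have "((\<lambda>t::complex. t powi m) \<longlongrightarrow> 0) (at 0)"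
    using assms(2) by (simp add: power_int_def power_0_left)
  from tendsto_mult[OF c(2) this] have "(\<lambda>t. w t / t powi m * t powi m) \<midarrow>0\<rightarrow> 0"
    by simp
  then show ?thesis
    by (rule Lim_transform_eventually) (use eventually_at_0_nonzero in eventually_elim, simp)
qed

text \<open>
  \<open>w + z = w (1 + z / w)\<close>, and the second factor tends to \<open>1\<close>.
\<close>
lemma has_order_add:
  assumes "has_order w m" and "has_order z n" and "m < n"
  shows "has_order (\<lambda>t. w t + z t) m"
proof -
  have "has_order (\<lambda>t. z t / w t) (n - m)"
    by (intro has_order_divide assms)
  then have "(\<lambda>t. z t / w t) \<midarrow>0\<rightarrow> 0"
    using has_order_pos_tendsto_0 assms(3) by simp
  from tendsto_add[OF tendsto_const[of 1] this]
  have "has_order (\<lambda>t. 1 + z t / w t) 0"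
    using assms(1,2)[THEN has_order_meromorphic]
    by (intro has_order_0I[where c = 1] meromorphic_intros) auto
  from has_order_mult[OF assms(1) this] have "has_order (\<lambda>t. w t * (1 + z t / w t)) m"
    by simp
  then show ?thesis
    by (rule has_order_cong)
       (use has_order_eventually_nonzero[OF assms(1)] in eventually_elim, simp add: field_simps)
qed

text \<open>
  The germ of a local coordinate: an injective holomorphic function has nonvanishing derivative.
  Local parametrizations are injective by definition only as maps to the curve, so this is applied to
  a function of the coordinates that separates the points of the curve near the centre.
\<close>
lemma injective_imp_has_order_1:
  assumes "w meromorphic_on {0}" and "w \<midarrow>0\<rightarrow> 0"
    and "r > 0" and inj: "inj_on w (ball 0 r - {0})"
  shows "has_order w 1"
proof -
  define W where "W = (\<lambda>t. if t = 0 then 0 else w t)"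
  obtain s where s: "s > 0" "W holomorphic_on ball 0 s"
    using meromorphic_tendsto_extends[OF assms(1,2)] unfolding W_def by blast
  \<comment> \<open>injectivity leaves at most one zero in the punctured disc; a smaller disc avoids it\<close>
  obtain q where q: "q > 0" "\<And>t. t \<in> ball 0 q - {0} \<Longrightarrow> w t \<noteq> 0"
  proof (cases "\<exists>t\<in>ball 0 r - {0}. w t = 0")
    case True
    then obtain t0 where t0: "t0 \<in> ball 0 r - {0}" "w t0 = 0" by blast
    show ?thesis
    proof (rule that[of "norm t0"])
      show "w t \<noteq> 0" if "t \<in> ball 0 (norm t0) - {0}" for t
        using inj_onD[OF inj, of t t0] t0 that by auto
    qed (use t0 in auto)
  qed (use \<open>r > 0\<close> in blast)
  define \<rho> where "\<rho> = min r (min s q)"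
  have \<rho>: "\<rho> > 0" "\<rho> \<le> r" "\<rho> \<le> s" "\<rho> \<le> q"
    using \<open>r > 0\<close> s q by (auto simp: \<rho>_def)
  have "inj_on W (ball 0 \<rho>)"
  proof (rule inj_onI)
    fix t t' assume t: "t \<in> ball 0 \<rho>" "t' \<in> ball 0 \<rho>" "W t = W t'"
    then show "t = t'"
      using inj_onD[OF inj, of t t'] q(2)[of t] q(2)[of t'] \<rho>
      by (auto simp: W_def split: if_splits)
  qed
  moreover have hol: "W holomorphic_on ball 0 \<rho>"
    using s(2) by (rule holomorphic_on_subset) (use \<rho> in auto)
  ultimately have "deriv W 0 \<noteq> 0"
    using \<rho> by (intro holomorphic_injective_imp_regular[of W "ball 0 \<rho>"]) auto
  moreover have "(W has_field_derivative deriv W 0) (at 0)"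
    using hol \<rho> by (intro holomorphic_derivI[where S = "ball 0 \<rho>"]) auto
  then have "(\<lambda>t. (W t - W 0) / (t - 0)) \<midarrow>0\<rightarrow> deriv W 0"
    by (simp only: has_field_derivative_iff)
  then have "(\<lambda>t. w t / t powi 1) \<midarrow>0\<rightarrow> deriv W 0"
    by (rule Lim_transform_eventually)
       (use eventually_at_0_nonzero in eventually_elim, simp add: W_def)
  ultimately show ?thesis
    using assms(1) by (auto simp: has_order_def)
qed

lemma meromorphic_on_poly:
  assumes "u meromorphic_on A"
  shows "(\<lambda>t. poly p (u t)) meromorphic_on A"
  by (induction p) (auto intro!: meromorphic_intros assms)

text \<open>
  Only the factor \<open>(u - x) ^ order x p\<close> of \<open>p(u)\<close> vanishes at \<open>u = x\<close>.
\<close>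
lemma has_order_poly_finite:
  assumes u: "has_order (\<lambda>t. u t - x) e" and e: "e > 0" and p: "p \<noteq> 0"
  shows "has_order (\<lambda>t. poly p (u t)) (e * int (order x p))"
proof -
  obtain q where q: "p = [:- x, 1:] ^ order x p * q" "\<not> [:- x, 1:] dvd q"
    using order_decomp[OF p] by blast
  have mer: "u meromorphic_on {0}"
    using meromorphic_on_add[OF has_order_meromorphic[OF u] meromorphic_on_const[of x]] by simp
  have lim: "u \<midarrow>0\<rightarrow> x"
    using tendsto_add[OF has_order_pos_tendsto_0[OF u e] tendsto_const[of x]] by simp
  have "poly q x \<noteq> 0"
    using q(2) by (simp add: poly_eq_0_iff_dvd)
  then have "has_order (\<lambda>t. poly q (u t)) 0"
    by (rule has_order_0I[OF meromorphic_on_poly[OF mer] tendsto_poly[OF lim]])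
  from has_order_mult[OF has_order_power[OF u, of "order x p"] this]
  have "has_order (\<lambda>t. (u t - x) ^ order x p * poly q (u t)) (e * int (order x p))"
    by simp
  moreover have "(u t - x) ^ order x p * poly q (u t) = poly p (u t)" for t
  proof -
    have "poly p (u t) = poly ([:- x, 1:] ^ order x p * q) (u t)"
      using q(1) by simp
    then show ?thesis by simp
  qed
  ultimately show ?thesis by simp
qed

text \<open>
  Near a pole of \<open>u\<close> the leading term of \<open>p(u)\<close> dominates: \<open>p(u) / u ^ degree p\<close> is the reflected
  polynomial in \<open>1 / u\<close>, which tends to the leading coefficient.
\<close>
lemma has_order_poly_infinite:
  assumes u: "has_order u (- e)" and e: "e > 0" and p: "p \<noteq> 0"
  shows "has_order (\<lambda>t. poly p (u t)) (- e * int (degree p))"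
proof -
  have inv: "has_order (\<lambda>t. inverse (u t)) e"
    using has_order_inverse[OF u] by simp
  have "has_order (\<lambda>t. poly (reflect_poly p) (inverse (u t))) 0"
    by (rule has_order_0I[OF meromorphic_on_poly[OF has_order_meromorphic[OF inv]]
          tendsto_poly[OF has_order_pos_tendsto_0[OF inv e]]]) (use p in simp)
  from has_order_mult[OF has_order_power[OF u, of "degree p"] this]
  have "has_order (\<lambda>t. u t ^ degree p * poly (reflect_poly p) (inverse (u t)))
          (- e * int (degree p))"
    by simp
  then show ?thesis
    by (rule has_order_cong)
       (use has_order_eventually_nonzero[OF u] in eventually_elim,
        simp add: poly_reflect_poly_nz field_simps)
qed

section \<open>Convergence in the one-point compactification\<close>

lemma closed_affine_curve: "closed (affine_curve f)"
proof -
  have "closed {z :: complex \<times> complex. snd z ^ 2 = poly f (fst z)}"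
    by (intro closed_Collect_eq continuous_intros continuous_on_poly)
  then show ?thesis
    by (simp add: affine_curve_def case_prod_unfold)
qed

lemma topspace_curve: "topspace (curve f) = insert None (Some ` affine_curve f)"
  by (simp add: curve_def)

lemma limitin_curve_SomeD:
  assumes "limitin (curve f) (\<lambda>t. Some (w t)) (Some z) F"
  shows "(w \<longlongrightarrow> z) F"
proof (rule topological_tendstoI)
  fix S :: "(complex \<times> complex) set" assume S: "open S" "z \<in> S"
  have "openin (curve f) (Some ` (affine_curve f \<inter> S))"
    using S by (simp add: curve_def openin_open_Int)
  moreover have "z \<in> affine_curve f"
    using limitin_topspace[OF assms] by (auto simp: topspace_curve)
  ultimately have "eventually (\<lambda>t. Some (w t) \<in> Some ` (affine_curve f \<inter> S)) F"
    using assms S by (simp add: limitin_def)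
  then show "eventually (\<lambda>t. w t \<in> S) F"
    by eventually_elim auto
qed

lemma limitin_curve_SomeI:
  assumes "(w \<longlongrightarrow> z) F" and "z \<in> affine_curve f"
    and "eventually (\<lambda>t. w t \<in> affine_curve f) F"
  shows "limitin (curve f) (\<lambda>t. Some (w t)) (Some z) F"
  unfolding limitin_def
proof (intro conjI allI impI)
  show "Some z \<in> topspace (curve f)"
    using assms(2) by (simp add: topspace_curve)
  fix U assume U: "openin (curve f) U \<and> Some z \<in> U"
  have "openin (top_of_set (affine_curve f)) {y \<in> affine_curve f. Some y \<in> U}"
    using openin_continuous_map_preimage[OF continuous_map_Some, of "top_of_set (affine_curve f)" U] U
    by (simp add: curve_def)
  then obtain S where S: "open S" "{y \<in> affine_curve f. Some y \<in> U} = affine_curve f \<inter> S"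
    by (auto simp: openin_open)
  then have "z \<in> S"
    using U assms(2) by auto
  with assms(1) S(1) have "eventually (\<lambda>t. w t \<in> S) F"
    by (rule topological_tendstoD)
  with assms(3) show "eventually (\<lambda>t. Some (w t) \<in> U) F"
    by eventually_elim (use S(2) in auto)
qed

text \<open>
  The points of the affine curve with \<open>x\<close> in a given disc form a compact set, because \<open>y\<close> is bounded
  by \<open>y ^ 2 = f x\<close> there. So leaving every compact set forces \<open>x\<close>, and not only the pair
  \<open>(x, y)\<close>, to tend to infinity.
\<close>
lemma limitin_curve_NoneD:
  assumes lim: "limitin (curve f) (\<lambda>t. Some (u t, v t)) None F"
    and ev: "eventually (\<lambda>t. (u t, v t) \<in> affine_curve f) F"
  shows "filterlim u at_infinity F"
  unfolding filterlim_at_infinity[OF order_refl]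
proof (intro allI impI)
  fix R :: real assume "R > 0"
  have "compact (poly f ` cball 0 R)"
    by (intro compact_continuous_image continuous_on_poly continuous_intros) auto
  then obtain M where "\<forall>x\<in>cball 0 R. norm (poly f x) \<le> M" and "M > 0"
    by (auto simp: bounded_pos dest!: compact_imp_bounded)
  then have M: "norm (poly f x) \<le> M" if "norm x \<le> R" for x
    using that by simp
  define K where "K = affine_curve f \<inter> (cball 0 R \<times> cball 0 (M + 1))"
  have "compact K"
    unfolding K_def by (intro closed_Int_compact closed_affine_curve compact_Times compact_cball)
  then have "openin (curve f) (insert None (Some ` (affine_curve f - K)))"
    unfolding curve_def openin_Alexandroff_compactification
    by (intro disjI2 exI[of _ K])
       (auto simp: compactin_subtopology K_def closedin_closed_Int compact_imp_closed
             intro!: closedin_subset closed_subset)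
  then have "eventually (\<lambda>t. Some (u t, v t) \<in> insert None (Some ` (affine_curve f - K))) F"
    using lim unfolding limitin_def by blast
  with ev show "eventually (\<lambda>t. norm (u t) \<ge> R) F"
  proof eventually_elim
    case (elim t)
    show ?case
    proof (rule ccontr)
      assume "\<not> R \<le> norm (u t)"
      then have u: "norm (u t) \<le> R" by simp
      have "norm (v t) ^ 2 = norm (poly f (u t))"
        using elim by (simp add: affine_curve_def flip: norm_power)
      also have "\<dots> \<le> M" by (rule M[OF u])
      also have "\<dots> \<le> (M + 1) ^ 2"
        using \<open>M > 0\<close> by (simp add: power2_eq_square algebra_simps)
      finally have "norm (v t) \<le> M + 1"
        by (rule power2_le_imp_le) (use \<open>M > 0\<close> in simp)
      then show False
        using elim u by (auto simp: K_def)
    qed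
  qed
qed

lemma limitin_curve_NoneI:
  assumes u: "filterlim u at_infinity F"
    and ev: "eventually (\<lambda>t. (u t, v t) \<in> affine_curve f) F"
  shows "limitin (curve f) (\<lambda>t. Some (u t, v t)) None F"
  unfolding limitin_def
proof (intro conjI allI impI)
  show "None \<in> topspace (curve f)"
    by (simp add: topspace_curve)
  fix U assume "openin (curve f) U \<and> None \<in> U"
  then obtain C where C: "compactin (top_of_set (affine_curve f)) C"
      "U = insert None (Some ` (affine_curve f - C))"
    by (auto simp: curve_def openin_Alexandroff_compactification)
  then have "bounded (fst ` C)"
    by (auto simp: compactin_subtopology intro!: bounded_fst dest: compact_imp_bounded)
  then obtain R where R: "R > 0" "\<And>z. z \<in> C \<Longrightarrow> norm (fst z) \<le> R"
    by (auto simp: bounded_pos)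
  have "eventually (\<lambda>t. norm (u t) \<ge> R + 1) F"
    using u R(1) by (simp add: filterlim_at_infinity[OF order_refl])
  with ev show "eventually (\<lambda>t. Some (u t, v t) \<in> U) F"
    by eventually_elim (use C(2) R(2) in force)
qed

section \<open>Orders of the coordinates along a local parametrization\<close>

text \<open>
  The defining properties of a local parametrization together with any property that holds near \<open>0\<close>,
  on one common punctured disc.
\<close>
lemma local_param_puncturedE:
  assumes "local_param f P (u, v)" and "eventually Q (at 0)"
  obtains r where "r > 0" and "inj_on (\<lambda>t. (u t, v t)) (ball 0 r - {0})"
    and "\<And>t. t \<in> ball 0 r - {0} \<Longrightarrow> v t ^ 2 = poly f (u t) \<and> Q t"
proof -
  obtain r1 where r1: "r1 > 0" "inj_on (\<lambda>t. (u t, v t)) (ball 0 r1 - {0})"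
      "\<forall>t \<in> ball 0 r1 - {0}. (u t, v t) \<in> affine_curve f"
    using assms(1) by (auto simp: local_param_def)
  obtain r2 where r2: "r2 > 0" "\<And>t. t \<in> ball 0 r2 - {0} \<Longrightarrow> Q t"
    using assms(2) by (auto simp: eventually_at dist_commute)
  show ?thesis
    by (rule that[of "min r1 r2"])
       (use r1 r2 in \<open>auto simp: affine_curve_def intro: inj_on_subset[OF r1(2)]\<close>)
qed

lemma local_param_meromorphic:
  assumes "local_param f P (u, v)"
  shows "u meromorphic_on {0}" and "v meromorphic_on {0}"
    and "eventually (\<lambda>t. v t ^ 2 = poly f (u t)) (at 0)"
proof -
  show "u meromorphic_on {0}" "v meromorphic_on {0}"
    using assms by (auto simp: local_param_def)
  obtain r where "r > 0" "\<And>t. t \<in> ball 0 r - {0} \<Longrightarrow> v t ^ 2 = poly f (u t)"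
    using local_param_puncturedE[OF assms, of "\<lambda>_. True"] by auto
  then show "eventually (\<lambda>t. v t ^ 2 = poly f (u t)) (at 0)"
    by (auto simp: eventually_at dist_commute)
qed

lemma local_param_tendsto:
  assumes "local_param f (Some (x, y)) (u, v)"
  shows "u \<midarrow>0\<rightarrow> x" and "v \<midarrow>0\<rightarrow> y"
proof -
  have "((\<lambda>t. (u t, v t)) \<longlongrightarrow> (x, y)) (at 0)"
    using assms by (intro limitin_curve_SomeD[of f]) (simp add: local_param_def)
  from tendsto_fst[OF this] tendsto_snd[OF this]
  show "u \<midarrow>0\<rightarrow> x" and "v \<midarrow>0\<rightarrow> y" by simp_all
qed

text \<open>
  Where \<open>y \<noteq> 0\<close>, the coordinate \<open>x\<close> alone separates nearby points: the other point over the same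
  value of \<open>x\<close> has coordinate \<open>- y\<close>, which is far away.
\<close>
lemma local_param_unramified:
  assumes "local_param f (Some (x, y)) (u, v)" and "y \<noteq> 0"
  shows "has_order (\<lambda>t. u t - x) 1"
proof -
  note lim = local_param_tendsto[OF assms(1)]
  have "eventually (\<lambda>t. dist (v t) y < norm y) (at 0)"
    using lim(2) assms(2) by (intro tendstoD) auto
  from local_param_puncturedE[OF assms(1) this] obtain r where r: "r > 0"
      "inj_on (\<lambda>t. (u t, v t)) (ball 0 r - {0})"
      "\<And>t. t \<in> ball 0 r - {0} \<Longrightarrow> v t ^ 2 = poly f (u t) \<and> dist (v t) y < norm y"
    by blast
  have "inj_on (\<lambda>t. u t - x) (ball 0 r - {0})"
  proof (rule inj_onI)
    fix t t' assume t: "t \<in> ball 0 r - {0}" "t' \<in> ball 0 r - {0}" "u t - x = u t' - x"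
    then have "v t ^ 2 = v t' ^ 2" using r(3) by auto
    moreover have "v t \<noteq> - v t'"
    proof
      assume eq: "v t = - v t'"
      have "norm (2 * y) = norm ((y - v t) + (y - v t'))"
        using eq by simp
      also have "\<dots> \<le> dist (v t) y + dist (v t') y"
        by (metis dist_commute dist_norm norm_triangle_ineq)
      also have "\<dots> < 2 * norm y"
        using r(3)[OF t(1)] r(3)[OF t(2)] by simp
      finally show False by (simp add: norm_mult)
    qed
    ultimately have "v t = v t'"
      by (simp add: power2_eq_iff)
    then show "t = t'"
      using inj_onD[OF r(2), of t t'] t by auto
  qed
  moreover have "(\<lambda>t. u t - x) \<midarrow>0\<rightarrow> 0"
    using tendsto_diff[OF lim(1) tendsto_const[of x]] by simp
  ultimately show ?thesis
    using local_param_meromorphic[OF assms(1)] r(1)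
    by (intro injective_imp_has_order_1) (auto intro!: meromorphic_intros)
qed

lemma poly_locally_injective:
  fixes f :: "complex poly"
  assumes "poly (pderiv f) x \<noteq> 0"
  obtains r where "r > 0" and "inj_on (poly f) (ball x r)"
proof -
  have "deriv (poly f) x \<noteq> 0"
    using assms DERIV_imp_deriv[OF poly_DERIV[of f x]] by simp
  then show ?thesis
    using has_complex_derivative_locally_injective[of "poly f" UNIV x] that
      poly_holomorphic_on[of "\<lambda>z. z" UNIV f] by (auto intro: holomorphic_intros)
qed

text \<open>
  The expression in \<open>s = 1 / x\<close> of the function \<open>x ^ (2 g) / f(x) = (x ^ g / y) ^ 2\<close> on a curve with
  \<open>degree f = 2 g + 1\<close>. It has a simple zero at \<open>s = 0\<close>, so near infinity \<open>x ^ g / y\<close> determines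
  \<open>x\<close>, and then also \<open>y\<close>.
\<close>
definition inf_quot :: "complex poly \<Rightarrow> complex \<Rightarrow> complex" where
  "inf_quot f s = s / poly (reflect_poly f) s"

lemma inf_quot_locally_injective:
  assumes "f \<noteq> 0"
  obtains r where "r > 0" and "inj_on (inf_quot f) (ball 0 r)"
    and "inf_quot f holomorphic_on ball 0 r"
    and "\<And>s. s \<in> ball 0 r \<Longrightarrow> poly (reflect_poly f) s \<noteq> 0"
proof -
  let ?F = "reflect_poly f"
  have "open (- {s. poly ?F s = 0})"
    using assms by (intro open_Compl finite_imp_closed poly_roots_finite) simp
  then obtain r0 where r0: "r0 > 0" "ball 0 r0 \<subseteq> - {s. poly ?F s = 0}"
    using assms by (auto elim!: openE)
  then have nz: "poly ?F s \<noteq> 0" if "s \<in> ball 0 r0" for s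
    using that by auto
  have hol: "inf_quot f holomorphic_on ball 0 r0"
    unfolding inf_quot_def by (intro holomorphic_intros nz)
  have "(inf_quot f has_field_derivative inverse (lead_coeff f)) (at 0)"
    unfolding inf_quot_def using assms
    by (auto intro!: derivative_eq_intros simp: field_simps)
  then have dnz: "deriv (inf_quot f) 0 \<noteq> 0"
    using assms by (simp add: DERIV_imp_deriv)
  have "(0::complex) \<in> ball 0 r0"
    using r0(1) by simp
  then obtain r where "r > 0" "ball (0::complex) r \<subseteq> ball 0 r0" "inj_on (inf_quot f) (ball 0 r)"
    using dnz by (rule has_complex_derivative_locally_injective[OF hol _ open_ball])
  then show ?thesis
    using that[of r] hol nz by (meson holomorphic_on_subset subsetD)
qed

locale odd_hyperelliptic =
  fixes f :: "complex poly" and g :: nat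
  assumes degree_f: "degree f = 2 * g + 1"
    and simple_roots: "rsquarefree f"
begin

lemma f_nonzero: "f \<noteq> 0"
  using degree_f by auto

lemma inf_quot_curve:
  assumes "y ^ 2 = poly f x" and "x \<noteq> 0"
  shows "inf_quot f (inverse x) = (x ^ g / y) ^ 2"
proof -
  have "poly (reflect_poly f) (inverse x) = poly f x / x ^ (2 * g + 1)"
    using assms(2) by (simp add: poly_reflect_poly_nz degree_f field_simps)
  also have "\<dots> = y ^ 2 / x ^ (2 * g + 1)"
    using assms(1) by simp
  finally have "inf_quot f (inverse x) = inverse x / (y ^ 2 / x ^ (2 * g + 1))"
    by (simp only: inf_quot_def)
  also have "\<dots> = (x ^ g / y) ^ 2"
    using assms(2) by (simp add: field_simps power2_eq_square flip: power_add mult_2)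
  finally show ?thesis .
qed

text \<open>
  Over a root of \<open>f\<close> the coordinate \<open>y\<close> separates nearby points, because \<open>f\<close> is injective near a
  simple root and so \<open>y ^ 2 = f x\<close> determines \<open>x\<close>. Hence \<open>y\<close> has order \<open>1\<close>, and
  \<open>x - x0 = y ^ 2 / h(x)\<close>, with \<open>h\<close> the cofactor of the simple root, has order \<open>2\<close>.
\<close>
lemma local_param_ramified:
  assumes "local_param f (Some (x, 0)) (u, v)"
  shows "has_order v 1" and "has_order (\<lambda>t. u t - x) 2"
proof -
  note lim = local_param_tendsto[OF assms] and mer = local_param_meromorphic[OF assms]
  have root: "poly f x = 0"
    using assms by (auto simp: local_param_def topspace_curve affine_curve_def
        dest!: limitin_topspace)
  then have simple: "poly (pderiv f) x \<noteq> 0"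
    using simple_roots by (auto simp: rsquarefree_roots)
  then obtain d where d: "d > 0" "inj_on (poly f) (ball x d)"
    by (rule poly_locally_injective)
  have "eventually (\<lambda>t. dist (u t) x < d) (at 0)"
    using lim(1) d(1) by (rule tendstoD)
  from local_param_puncturedE[OF assms this] obtain r where r: "r > 0"
      "inj_on (\<lambda>t. (u t, v t)) (ball 0 r - {0})"
      "\<And>t. t \<in> ball 0 r - {0} \<Longrightarrow> v t ^ 2 = poly f (u t) \<and> dist (u t) x < d"
    by blast
  have "inj_on v (ball 0 r - {0})"
  proof (rule inj_onI)
    fix t t' assume t: "t \<in> ball 0 r - {0}" "t' \<in> ball 0 r - {0}" "v t = v t'"
    then have "poly f (u t) = poly f (u t')" using r(3) by metis
    moreover have "u t \<in> ball x d" "u t' \<in> ball x d"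
      using r(3)[OF t(1)] r(3)[OF t(2)] by (auto simp: dist_commute)
    ultimately have "u t = u t'"
      using inj_onD[OF d(2)] by blast
    then show "t = t'"
      using inj_onD[OF r(2), of t t'] t by auto
  qed
  then show v: "has_order v 1"
    using mer lim(2) r(1) by (intro injective_imp_has_order_1)
  obtain h where h: "f = [:- x, 1:] * h"
    using root by (auto simp: poly_eq_0_iff_dvd)
  have f: "poly f z = (z - x) * poly h z" for z
    by (simp add: h algebra_simps)
  have "poly h x \<noteq> 0"
    using simple by (simp add: h pderiv_mult pderiv_pCons del: mult_pCons_left)
  then have h0: "has_order (\<lambda>t. poly h (u t)) 0"
    by (intro has_order_0I[OF meromorphic_on_poly[OF mer(1)] tendsto_poly[OF lim(1)]])
  have "has_order (\<lambda>t. v t ^ 2 / poly h (u t)) 2"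
    using has_order_divide[OF has_order_power[OF v, of 2] h0] by simp
  then show "has_order (\<lambda>t. u t - x) 2"
    by (rule has_order_cong)
       (use mer(3) has_order_eventually_nonzero[OF h0] in eventually_elim, simp add: f)
qed

text \<open>
  At infinity the coordinate is \<open>w = x ^ g / y\<close>. It has order \<open>1\<close> since \<open>w ^ 2\<close> determines \<open>x\<close>
  near infinity, and then the orders of \<open>x\<close> and \<open>y = x ^ g / w\<close> follow from
  \<open>1 / x = w ^ 2 F(1 / x)\<close>, where \<open>F\<close> is the reflected polynomial of \<open>f\<close> and \<open>F(0) \<noteq> 0\<close>.
\<close>
lemma local_param_infinite:
  assumes "local_param f None (u, v)"
  shows "has_order u (- 2)" and "has_order v (- int (2 * g + 1))"
proof -
  note mer = local_param_meromorphic[OF assms]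
  obtain d where d: "d > 0" "inj_on (inf_quot f) (ball 0 d)"
    using inf_quot_locally_injective[OF f_nonzero] by blast
  have u: "filterlim u at_infinity (at 0)"
    using assms mer(3) by (intro limitin_curve_NoneD) (auto simp: local_param_def affine_curve_def)
  have inv: "(\<lambda>t. inverse (u t)) \<midarrow>0\<rightarrow> 0"
    by (rule filterlim_compose[OF tendsto_inverse_0 u])
  define w where "w = (\<lambda>t. u t ^ g / v t)"
  have F: "(\<lambda>t. poly (reflect_poly f) (inverse (u t))) \<midarrow>0\<rightarrow> lead_coeff f"
    using tendsto_poly[OF inv, of "reflect_poly f"] by simp
  then have F0: "has_order (\<lambda>t. poly (reflect_poly f) (inverse (u t))) 0"
    using f_nonzero mer by (intro has_order_0I) (auto intro!: meromorphic_on_poly meromorphic_intros)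
  have unz: "eventually (\<lambda>t. u t \<noteq> 0) (at 0)"
    using filterlim_at_infinity_imp_eventually_ne[OF u] .
  have quot: "eventually (\<lambda>t. inf_quot f (inverse (u t)) = w t ^ 2) (at 0)"
    using unz mer(3) by eventually_elim (simp add: inf_quot_curve w_def)
  have "(\<lambda>t. inf_quot f (inverse (u t))) \<midarrow>0\<rightarrow> 0 / lead_coeff f"
    unfolding inf_quot_def using f_nonzero by (intro tendsto_divide inv F) simp
  then have "(\<lambda>t. w t ^ 2) \<midarrow>0\<rightarrow> 0"
    using Lim_transform_eventually quot by force
  then have "(\<lambda>t. sqrt (norm (w t ^ 2))) \<midarrow>0\<rightarrow> 0"
    using tendsto_real_sqrt[OF tendsto_norm_zero] by fastforce
  then have w0: "w \<midarrow>0\<rightarrow> 0"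
    by (simp add: norm_power tendsto_norm_zero_iff)
  have "eventually (\<lambda>t. dist (inverse (u t)) 0 < d) (at 0)"
    using inv d(1) by (rule tendstoD)
  from local_param_puncturedE[OF assms eventually_conj[OF this eventually_conj[OF unz quot]]]
  obtain r where r: "r > 0" "inj_on (\<lambda>t. (u t, v t)) (ball 0 r - {0})"
      "\<And>t. t \<in> ball 0 r - {0} \<Longrightarrow> v t ^ 2 = poly f (u t) \<and> dist (inverse (u t)) 0 < d \<and>
         u t \<noteq> 0 \<and> inf_quot f (inverse (u t)) = w t ^ 2"
    by blast
  have "inj_on w (ball 0 r - {0})"
  proof (rule inj_onI)
    fix t t' assume t: "t \<in> ball 0 r - {0}" "t' \<in> ball 0 r - {0}" "w t = w t'"
    then have "inf_quot f (inverse (u t)) = inf_quot f (inverse (u t'))"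
      using r(3) by metis
    moreover have "inverse (u t) \<in> ball 0 d" "inverse (u t') \<in> ball 0 d"
      using r(3)[OF t(1)] r(3)[OF t(2)] by auto
    ultimately have "u t = u t'"
      using inj_onD[OF d(2)] by (metis inverse_inverse_eq)
    moreover have "v t = v t'"
      using t(3) \<open>u t = u t'\<close> r(3)[OF t(1)] by (simp add: w_def)
    ultimately show "t = t'"
      using inj_onD[OF r(2), of t t'] t by auto
  qed
  then have w: "has_order w 1"
    using mer w0 r(1) unfolding w_def
    by (intro injective_imp_has_order_1) (auto intro!: meromorphic_intros)
  have "has_order (\<lambda>t. w t ^ 2 * poly (reflect_poly f) (inverse (u t))) 2"
    using has_order_mult[OF has_order_power[OF w, of 2] F0] by simp
  moreover have "eventually (\<lambda>t. w t ^ 2 * poly (reflect_poly f) (inverse (u t)) = inverse (u t)) (at 0)"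
    using quot has_order_eventually_nonzero[OF F0]
  proof eventually_elim
    case (elim t)
    then show ?case
      unfolding inf_quot_def by (metis nonzero_divide_eq_eq)
  qed
  ultimately have "has_order (\<lambda>t. inverse (u t)) 2"
    by (rule has_order_cong)
  from has_order_inverse[OF this] show u2: "has_order u (- 2)"
    by simp
  have "- 2 * int g - 1 = - int (2 * g + 1)"
    by simp
  then have "has_order (\<lambda>t. u t ^ g / w t) (- int (2 * g + 1))"
    using has_order_divide[OF has_order_power[OF u2, of g] w] by (simp only:)
  then show "has_order v (- int (2 * g + 1))"
  proof (rule has_order_cong)
    show "eventually (\<lambda>t. u t ^ g / w t = v t) (at 0)"
      using unz has_order_eventually_nonzero[OF w]
    proof eventually_elim
      case (elim t)
      then show ?case
        by (cases "v t = 0") (simp_all add: w_def)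
    qed
  qed
qed

end

section \<open>Existence of local parametrizations\<close>

text \<open>
  Substituting \<open>t ^ 2\<close> into the local inverse of \<open>F\<close> solves \<open>F (s t) = t ^ 2\<close>. This parametrizes
  the curve near a root of \<open>f\<close>, with \<open>F = f\<close> and \<open>y = t\<close>, and near infinity, with \<open>F\<close> the quotient
  \<^const>\<open>inf_quot\<close>, \<open>s = 1 / x\<close> and \<open>x ^ g / y = t\<close>.
\<close>
lemma holomorphic_inverse_of_square:
  assumes hol: "F holomorphic_on ball a r" and inj: "inj_on F (ball a r)"
    and "F a = 0" and "r > 0"
  obtains \<rho> s where "\<rho> > 0" and "s holomorphic_on ball 0 \<rho>" and "s 0 = a"
    and "\<And>t. t \<in> ball 0 \<rho> \<Longrightarrow> s t \<in> ball a r \<and> F (s t) = t ^ 2"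
proof -
  obtain G where G: "G holomorphic_on F ` ball a r" "\<And>z. z \<in> ball a r \<Longrightarrow> G (F z) = z"
    by (rule holomorphic_has_inverse[OF hol open_ball inj]) blast
  have "open (F ` ball a r)"
    by (rule open_mapping_thm3[OF hol open_ball inj])
  moreover have "0 \<in> F ` ball a r"
    using assms(3,4) by (metis centre_in_ball imageI)
  ultimately obtain d where d: "d > 0" "ball 0 d \<subseteq> F ` ball a r"
    by (auto elim!: openE)
  define \<rho> where "\<rho> = min 1 d"
  have sq: "t ^ 2 \<in> ball 0 d" if "t \<in> ball 0 \<rho>" for t :: complex
  proof -
    have "norm t * norm t \<le> 1 * norm t"
      using that by (intro mult_right_mono) (auto simp: \<rho>_def)
    then show ?thesis
      using that by (simp add: \<rho>_def norm_power power2_eq_square norm_mult)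
  qed
  show ?thesis
  proof (rule that[of \<rho> "\<lambda>t. G (t ^ 2)"])
    show "\<rho> > 0" using d by (simp add: \<rho>_def)
    have "(G \<circ> (\<lambda>t. t ^ 2)) holomorphic_on ball 0 \<rho>"
      by (rule holomorphic_on_compose_gen[OF _ G(1)])
         (use sq d(2) in \<open>auto intro!: holomorphic_intros\<close>)
    then show "(\<lambda>t. G (t ^ 2)) holomorphic_on ball 0 \<rho>"
      by (simp add: o_def)
    show "G (0 ^ 2) = a"
      using G(2)[of a] assms(3,4) by simp
    show "G (t ^ 2) \<in> ball a r \<and> F (G (t ^ 2)) = t ^ 2" if t: "t \<in> ball 0 \<rho>" for t
    proof -
      obtain z where "z \<in> ball a r" "t ^ 2 = F z"
        using sq[OF t] d(2) by blast
      then show ?thesis using G(2) by simp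
    qed
  qed
qed

lemma analytic_on_poly: "u analytic_on A \<Longrightarrow> (\<lambda>t. poly p (u t)) analytic_on A"
  by (induction p) (auto intro!: analytic_intros)

lemma local_param_SomeI:
  assumes u: "u analytic_on {0}" and v: "v analytic_on {0}" and "u 0 = x" and "v 0 = y"
    and r: "r > 0" and on: "\<And>t. t \<in> ball 0 r \<Longrightarrow> v t ^ 2 = poly f (u t)"
    and inj: "inj_on (\<lambda>t. (u t, v t)) (ball 0 r - {0})"
  shows "local_param f (Some (x, y)) (u, v)"
proof -
  have "u \<midarrow>0\<rightarrow> x" "v \<midarrow>0\<rightarrow> y"
    using assms(3,4) analytic_at_imp_isCont[OF u] analytic_at_imp_isCont[OF v]
    by (auto simp: isCont_def)
  then have "((\<lambda>t. (u t, v t)) \<longlongrightarrow> (x, y)) (at 0)"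
    by (rule tendsto_Pair)
  moreover have "(x, y) \<in> affine_curve f"
    using on[of 0] assms(3,4) r by (simp add: affine_curve_def)
  moreover have "eventually (\<lambda>t. (u t, v t) \<in> affine_curve f) (at 0)"
    using r on by (auto simp: eventually_at dist_commute affine_curve_def)
  ultimately have "limitin (curve f) (\<lambda>t. Some (u t, v t)) (Some (x, y)) (at 0)"
    by (rule limitin_curve_SomeI)
  then show ?thesis
    using u v r on inj unfolding local_param_def
    by (auto intro!: analytic_on_imp_meromorphic_on exI[of _ r] simp: affine_curve_def)
qed

text \<open>
  Dividing by \<open>y ^ 2\<close> moves the argument of the square root to values near \<open>1\<close>, where \<^const>\<open>csqrt\<close> is
  holomorphic; the factor \<open>y\<close> outside selects the branch through \<open>(x, y)\<close>.
\<close>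
lemma ex_local_param_unramified:
  assumes "y ^ 2 = poly f x" and "y \<noteq> 0"
  shows "\<exists>u v. local_param f (Some (x, y)) (u, v)"
proof (intro exI local_param_SomeI)
  show "(\<lambda>t. x + t) analytic_on {0}"
    by (intro analytic_intros)
  show "(\<lambda>t. y * csqrt (poly f (x + t) / y ^ 2)) analytic_on {0}"
    using assms by (intro analytic_intros analytic_on_poly) auto
  show "y * csqrt (poly f (x + 0) / y ^ 2) = y"
    using assms by (metis add.right_neutral csqrt_1 divide_self mult.right_neutral power_not_zero)
  show "(y * csqrt (poly f (x + t) / y ^ 2)) ^ 2 = poly f (x + t)" for t
    using assms(2) by (simp add: power_mult_distrib)
  show "(1::real) > 0" by simp
qed (auto simp: inj_on_def)

context odd_hyperelliptic
begin

lemma ex_local_param_ramified: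
  assumes root: "poly f x = 0"
  shows "\<exists>u v. local_param f (Some (x, 0)) (u, v)"
proof -
  have "poly (pderiv f) x \<noteq> 0"
    using simple_roots root by (auto simp: rsquarefree_roots)
  then obtain r where r: "r > 0" "inj_on (poly f) (ball x r)"
    by (rule poly_locally_injective)
  have "poly f holomorphic_on ball x r"
    using poly_holomorphic_on[of "\<lambda>z. z" "ball x r" f] by (auto intro: holomorphic_intros)
  from holomorphic_inverse_of_square[OF this r(2) root r(1)]
  obtain \<rho> s where s: "\<rho> > 0" "s holomorphic_on ball 0 \<rho>" "s 0 = x"
      "\<And>t. t \<in> ball 0 \<rho> \<Longrightarrow> s t \<in> ball x r \<and> poly f (s t) = t ^ 2"
    by blast
  have "local_param f (Some (x, 0)) (s, \<lambda>t. t)"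
  proof (rule local_param_SomeI)
    show "s analytic_on {0}"
      using s(1,2) by (auto simp: analytic_at_ball)
    show "(\<lambda>t::complex. t) analytic_on {0}"
      by (intro analytic_intros)
    show "t ^ 2 = poly f (s t)" if "t \<in> ball 0 \<rho>" for t
      using s(4)[OF that] by simp
  qed (use s in \<open>auto simp: inj_on_def\<close>)
  then show ?thesis by blast
qed

lemma ex_local_param_infinite: "\<exists>u v. local_param f None (u, v)"
proof -
  obtain r where r: "r > 0" "inj_on (inf_quot f) (ball 0 r)" "inf_quot f holomorphic_on ball 0 r"
      "\<And>s. s \<in> ball 0 r \<Longrightarrow> poly (reflect_poly f) s \<noteq> 0"
    by (rule inf_quot_locally_injective[OF f_nonzero]) blast
  have "inf_quot f 0 = 0"
    by (simp add: inf_quot_def)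
  from holomorphic_inverse_of_square[OF r(3,2) this r(1)]
  obtain \<rho> s where s: "\<rho> > 0" "s holomorphic_on ball 0 \<rho>" "s 0 = 0"
      "\<And>t. t \<in> ball 0 \<rho> \<Longrightarrow> s t \<in> ball 0 r \<and> inf_quot f (s t) = t ^ 2"
    by blast
  define u where "u = (\<lambda>t. inverse (s t))"
  define v where "v = (\<lambda>t. u t ^ g / t)"
  have snz: "s t \<noteq> 0" if "t \<in> ball 0 \<rho> - {0}" for t
    using s(4)[of t] that by (auto simp: inf_quot_def)
  have s_an: "s analytic_on {0}"
    using s(1,2) by (auto simp: analytic_at_ball)
  have on: "v t ^ 2 = poly f (u t)" if t: "t \<in> ball 0 \<rho> - {0}" for t
  proof -
    have u0: "u t \<noteq> 0" and st: "inverse (u t) = s t"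
      using snz[OF t] by (auto simp: u_def)
    have "t ^ 2 = s t / poly (reflect_poly f) (s t)"
      using s(4)[of t] t by (simp add: inf_quot_def)
    also have "poly (reflect_poly f) (s t) = poly f (u t) / u t ^ (2 * g + 1)"
      using snz[OF t] by (simp add: poly_reflect_poly_nz degree_f u_def field_simps)
    finally have "t ^ 2 = inverse (u t) / (poly f (u t) / u t ^ (2 * g + 1))"
      by (simp only: st)
    moreover have "t \<noteq> 0" using t by simp
    moreover from calculation have "poly f (u t) \<noteq> 0" by auto
    ultimately show ?thesis
      using u0 by (simp add: v_def field_simps power2_eq_square flip: power_add mult_2)
  qed
  have s_mer: "s meromorphic_on {0}"
    by (rule analytic_on_imp_meromorphic_on[OF s_an])
  have ev: "eventually (\<lambda>t. (u t, v t) \<in> affine_curve f) (at 0)"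
    using s(1) on by (auto simp: eventually_at dist_commute affine_curve_def)
  have "s \<midarrow>0\<rightarrow> 0"
    using analytic_at_imp_isCont[OF s_an] s(3) by (simp add: isCont_def)
  moreover have "eventually (\<lambda>t. s t \<noteq> 0) (at 0)"
    using s(1) snz by (auto simp: eventually_at dist_commute)
  ultimately have "filterlim s (at 0) (at 0)"
    by (simp add: filterlim_at)
  then have "filterlim u at_infinity (at 0)"
    unfolding u_def by (rule filterlim_compose[OF filterlim_inverse_at_infinity])
  then have "limitin (curve f) (\<lambda>t. Some (u t, v t)) None (at 0)"
    using ev by (rule limitin_curve_NoneI)
  moreover have "inj_on (\<lambda>t. (u t, v t)) (ball 0 \<rho> - {0})"
  proof (rule inj_onI)
    fix t t' assume t: "t \<in> ball 0 \<rho> - {0}" "t' \<in> ball 0 \<rho> - {0}" "(u t, v t) = (u t', v t')"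
    have "t = u t ^ g / v t" "t' = u t' ^ g / v t'"
      using snz[OF t(1)] snz[OF t(2)] by (auto simp: v_def u_def)
    then show "t = t'" using t(3) by simp
  qed
  moreover have "\<forall>t\<in>ball 0 \<rho> - {0}. (u t, v t) \<in> affine_curve f"
    using on by (simp add: affine_curve_def)
  moreover have "u meromorphic_on {0}" "v meromorphic_on {0}"
    unfolding u_def v_def by (intro meromorphic_intros s_mer)+
  ultimately have "local_param f None (u, v)"
    using s(1) unfolding local_param_def by blast
  then show ?thesis by blast
qed

lemma ex_local_param:
  assumes "P \<in> topspace (curve f)"
  shows "\<exists>u v. local_param f P (u, v)"
proof (cases P)
  case None
  then show ?thesis using ex_local_param_infinite by simp
next
  case (Some z)
  then obtain x y where P: "P = Some (x, y)" "y ^ 2 = poly f x"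
    using assms by (auto simp: topspace_curve affine_curve_def)
  then show ?thesis
    using ex_local_param_unramified ex_local_param_ramified by (cases "y = 0") auto
qed

text \<open>
  All orders at a point are computed with the same chosen parametrization. Since the orders of the
  coordinates were found for every parametrization, which one is chosen does not matter.
\<close>
lemma ord_at_local_paramE:
  assumes "P \<in> topspace (curve f)"
  obtains u v where "local_param f P (u, v)"
    and "\<And>h. ord_at f P h = zorder (\<lambda>t. ratfun_eval h (u t) (v t)) 0"
proof -
  obtain u v where uv: "(SOME uv. local_param f P uv) = (u, v)"
    by fastforce
  moreover have "local_param f P (SOME uv. local_param f P uv)"
    using ex_local_param[OF assms] by (metis someI_ex)
  ultimately show ?thesis
    using that by (simp add: ord_at_def)
qed

end

section \<open>Rational functions as fractions of polynomials\<close>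

text \<open>
  The reduced denominator divides every other denominator, so it does not vanish at \<open>x\<close> either.
\<close>
lemma fract_eval_Fract:
  assumes "poly d x \<noteq> 0"
  shows "fract_eval (Fract n d) x = poly n x / poly d x"
proof -
  obtain n' d' where nd: "quot_of_fract (Fract n d) = (n', d')"
    by fastforce
  have "d \<noteq> 0" using assms by auto
  have "d' \<noteq> 0"
    using snd_quot_of_fract_nonzero[of "Fract n d"] by (simp add: nd)
  moreover have "Fract n' d' = Fract n d"
    using Fract_quot_of_fract[of "Fract n d"] by (simp add: nd)
  ultimately have eq: "n' * d = n * d'"
    using \<open>d \<noteq> 0\<close> by (simp add: eq_fract)
  have "coprime n' d'"
    using quot_of_fract_in_normalized_fracts[of "Fract n d"] by (simp add: nd normalized_fracts_def)
  then have "d' dvd d"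
    using eq by (metis coprime_commute coprime_dvd_mult_right_iff dvd_triv_right)
  then have "poly d' x \<noteq> 0"
    using assms by (auto elim!: dvdE)
  moreover have "poly n' x * poly d x = poly n x * poly d' x"
    using eq by (metis poly_mult)
  ultimately show ?thesis
    using assms by (simp add: fract_eval_def nd field_simps)
qed

lemma fract_eval_to_fract [simp]: "fract_eval (to_fract a) x = poly a x"
  by (simp add: fract_eval_def)

lemma fract_eval_0 [simp]: "fract_eval 0 x = 0"
  by (simp add: fract_eval_def)

text \<open>
  A common denominator of least degree: a common root of \<open>A\<close>, \<open>B\<close> and \<open>d\<close> could be divided out.
\<close>
lemma common_denominator:
  fixes a b :: "complex poly fract"
  obtains A B d where "d \<noteq> 0" and "a = Fract A d" and "b = Fract B d"
    and "\<And>x. poly d x = 0 \<Longrightarrow> poly A x \<noteq> 0 \<or> poly B x \<noteq> 0"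
proof -
  define R where "R = (\<lambda>(A, B, d). d \<noteq> 0 \<and> a = Fract A d \<and> b = Fract B d)"
  obtain A1 d1 where 1: "a = Fract A1 d1" "d1 \<noteq> 0"
    by (cases a)
  obtain B1 d2 where 2: "b = Fract B1 d2" "d2 \<noteq> 0"
    by (cases b)
  have "R (A1 * d2, B1 * d1, d1 * d2)"
    using 1 2 by (simp add: R_def eq_fract)
  then obtain z where z: "R z" "\<And>z'. R z' \<Longrightarrow> degree (snd (snd z)) \<le> degree (snd (snd z'))"
    using ex_has_least_nat[of R _ "\<lambda>z. degree (snd (snd z))"] by blast
  obtain A B d where Abd: "z = (A, B, d)"
    by (cases z)
  have "poly A x \<noteq> 0 \<or> poly B x \<noteq> 0" if "poly d x = 0" for x
  proof (rule ccontr)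
    assume "\<not> ?thesis"
    with that obtain A' B' d' where div: "A = [:- x, 1:] * A'" "B = [:- x, 1:] * B'"
        "d = [:- x, 1:] * d'"
      by (auto simp: poly_eq_0_iff_dvd elim!: dvdE)
    have "d' \<noteq> 0"
      using z(1) by (auto simp: Abd R_def div)
    then have "R (A', B', d')"
      using z(1) by (simp add: Abd R_def div eq_fract del: mult_pCons_left)
    from z(2)[OF this] have "degree ([:- x, 1:] * d') \<le> degree d'"
      by (simp add: Abd div)
    moreover have "degree ([:- x, 1:] * d') = degree [:- x, 1:] + degree d'"
      by (rule degree_mult_eq) (use \<open>d' \<noteq> 0\<close> in auto)
    ultimately show False by simp
  qed
  then show ?thesis
    using that z(1) by (auto simp: Abd R_def)
qed

section \<open>Orders of functions on the curve\<close>

context odd_hyperelliptic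
begin

definition ram :: "point \<Rightarrow> int" where
  "ram P = (case P of None \<Rightarrow> 2 | Some (x, y) \<Rightarrow> if y = 0 then 2 else 1)"

lemma ram_pos: "ram P > 0"
  by (auto simp: ram_def split: option.splits)

lemma local_param_ram:
  assumes "local_param f (Some (x, y)) (u, v)"
  shows "has_order (\<lambda>t. u t - x) (ram (Some (x, y)))"
  using local_param_unramified[of f x y u v] local_param_ramified[of x u v] assms
  by (auto simp: ram_def)

lemma ord_at_poly_finite:
  assumes "Some (x, y) \<in> topspace (curve f)" and "a \<noteq> 0"
  shows "ord_at f (Some (x, y)) (to_fract a, 0) = ram (Some (x, y)) * int (order x a)"
proof -
  obtain u v where uv: "local_param f (Some (x, y)) (u, v)"
      "\<And>h. ord_at f (Some (x, y)) h = zorder (\<lambda>t. ratfun_eval h (u t) (v t)) 0"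
    by (rule ord_at_local_paramE[OF assms(1)]) blast
  have "has_order (\<lambda>t. poly a (u t)) (ram (Some (x, y)) * int (order x a))"
    by (rule has_order_poly_finite[OF local_param_ram[OF uv(1)] ram_pos assms(2)])
  then show ?thesis
    by (simp add: uv(2) ratfun_eval_def has_order_imp_zorder)
qed

lemma ord_at_infinite:
  obtains u v where "has_order u (- 2)" and "has_order v (- int (2 * g + 1))"
    and "\<And>h. ord_at f None h = zorder (\<lambda>t. ratfun_eval h (u t) (v t)) 0"
proof -
  have "None \<in> topspace (curve f)"
    by (simp add: topspace_curve)
  then obtain u v where uv: "local_param f None (u, v)"
      "\<And>h. ord_at f None h = zorder (\<lambda>t. ratfun_eval h (u t) (v t)) 0"
    by (rule ord_at_local_paramE) blast
  then show ?thesis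
    using that local_param_infinite by blast
qed

lemma ord_at_poly_infinite:
  assumes "a \<noteq> 0"
  shows "ord_at f None (to_fract a, 0) = - 2 * int (degree a)"
proof (rule ord_at_infinite)
  fix u v
  assume u: "has_order u (- 2)"
    and ord: "\<And>h. ord_at f None h = zorder (\<lambda>t. ratfun_eval h (u t) (v t)) 0"
  have "has_order (\<lambda>t. poly a (u t)) (- 2 * int (degree a))"
    by (rule has_order_poly_infinite[OF u _ assms]) simp
  then show ?thesis
    by (simp add: ord ratfun_eval_def has_order_imp_zorder)
qed

lemma ramification_index_eq:
  assumes "P \<in> topspace (curve f)"
  shows "ramification_index f P = ram P"
proof (cases P)
  case None
  show ?thesis
    unfolding None
  proof (rule ord_at_infinite)
    fix u v
    assume u: "has_order u (- 2)"
      and ord: "\<And>h. ord_at f None h = zorder (\<lambda>t. ratfun_eval h (u t) (v t)) 0"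
    have "has_order (\<lambda>t. inverse (u t)) 2"
      using has_order_inverse[OF u] by simp
    moreover have "eventually (\<lambda>t. inverse (u t) = ratfun_eval (Fract 1 [:0, 1:], 0) (u t) (v t)) (at 0)"
      using has_order_eventually_nonzero[OF u]
      by eventually_elim (simp add: ratfun_eval_def fract_eval_Fract inverse_eq_divide)
    ultimately have "has_order (\<lambda>t. ratfun_eval (Fract 1 [:0, 1:], 0) (u t) (v t)) 2"
      by (rule has_order_cong)
    then show "ramification_index f None = ram None"
      by (simp add: ramification_index_def ord ram_def has_order_imp_zorder)
  qed
next
  case (Some z)
  obtain x y where P: "P = Some (x, y)"
    using Some by (cases z) auto
  have "order x [:- x, 1:] = 1"
    using order_power_n_n[of x 1] by simp
  then show ?thesis
    using ord_at_poly_finite[of x y "[:- x, 1:]"] assms by (simp add: P ramification_index_def)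
qed

text \<open>
  The second alternative concerns the points with \<open>y = 0\<close>: there \<open>B(x) y\<close> has order \<open>1\<close>
  if \<open>B\<close> does not vanish at \<open>x\<close>, and no \<open>A(x)\<close> cancels it, because \<open>A(x)\<close> has even order.
\<close>
lemma has_order_numerator:
  assumes uv: "local_param f (Some (x, y)) (u, v)"
    and num: "poly A x + poly B x * y \<noteq> 0 \<or> y = 0 \<and> poly B x \<noteq> 0"
  shows "\<exists>n < ram (Some (x, y)). has_order (\<lambda>t. poly A (u t) + poly B (u t) * v t) n"
proof (cases "poly A x + poly B x * y = 0")
  note mer = local_param_meromorphic[OF uv] and lim = local_param_tendsto[OF uv]
  case False
  have "has_order (\<lambda>t. poly A (u t) + poly B (u t) * v t) 0"
    by (rule has_order_0I[OF _ _ False])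
       (auto intro!: meromorphic_intros meromorphic_on_poly mer tendsto_intros lim)
  then show ?thesis using ram_pos by blast
next
  note mer = local_param_meromorphic[OF uv] and lim = local_param_tendsto[OF uv]
  case True
  with num have y: "y = 0" and A: "poly A x = 0" and B: "poly B x \<noteq> 0" by auto
  note ramified = local_param_ramified[OF uv[unfolded y]]
  have "has_order (\<lambda>t. poly B (u t)) 0"
    by (rule has_order_0I[OF meromorphic_on_poly[OF mer(1)] tendsto_poly[OF lim(1)] B])
  from has_order_mult[OF this ramified(1)]
  have Bv: "has_order (\<lambda>t. poly B (u t) * v t) 1"
    by simp
  have "has_order (\<lambda>t. poly A (u t) + poly B (u t) * v t) 1"
  proof (cases "A = 0")
    case True
    then show ?thesis using Bv by simp
  next
    case False
    then have "order x A > 0"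
      using A by (simp add: order_gt_0_iff)
    then have "1 < 2 * int (order x A)" by simp
    moreover have "has_order (\<lambda>t. poly A (u t)) (2 * int (order x A))"
      by (rule has_order_poly_finite[OF ramified(2) _ False]) simp
    ultimately show ?thesis
      using has_order_add[OF Bv] by (simp add: add.commute)
  qed
  then show ?thesis
    by (intro exI[of _ 1]) (simp add: ram_def y)
qed

lemma ord_at_negative_pole:
  assumes P: "Some (x, y) \<in> topspace (curve f)"
    and d: "d \<noteq> 0" "poly d x = 0"
    and num: "poly A x + poly B x * y \<noteq> 0 \<or> y = 0 \<and> poly B x \<noteq> 0"
  shows "ord_at f (Some (x, y)) (Fract A d, Fract B d) < 0"
proof -
  let ?r = "ram (Some (x, y))"
  obtain u v where uv: "local_param f (Some (x, y)) (u, v)"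
      "\<And>h. ord_at f (Some (x, y)) h = zorder (\<lambda>t. ratfun_eval h (u t) (v t)) 0"
    by (rule ord_at_local_paramE[OF P]) blast
  have d_ord: "has_order (\<lambda>t. poly d (u t)) (?r * int (order x d))"
    by (rule has_order_poly_finite[OF local_param_ram[OF uv(1)] ram_pos d(1)])
  obtain n where n: "n < ?r" "has_order (\<lambda>t. poly A (u t) + poly B (u t) * v t) n"
    using has_order_numerator[OF uv(1) num] by blast
  have "eventually (\<lambda>t. (poly A (u t) + poly B (u t) * v t) / poly d (u t) =
      ratfun_eval (Fract A d, Fract B d) (u t) (v t)) (at 0)"
    using has_order_eventually_nonzero[OF d_ord]
    by eventually_elim (simp add: ratfun_eval_def fract_eval_Fract add_divide_distrib)
  with has_order_divide[OF n(2) d_ord]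
  have "has_order (\<lambda>t. ratfun_eval (Fract A d, Fract B d) (u t) (v t)) (n - ?r * int (order x d))"
    by (rule has_order_cong)
  then have "ord_at f (Some (x, y)) (Fract A d, Fract B d) = n - ?r * int (order x d)"
    by (simp add: uv(2) has_order_imp_zorder)
  moreover have "int (order x d) \<ge> 1"
    using d order_gt_0_iff[of d x] by simp
  then have "?r * int (order x d) \<ge> ?r"
    using ram_pos[of "Some (x, y)"] by (simp add: mult_le_cancel_left1)
  ultimately show ?thesis
    using n(1) by linarith
qed

text \<open>
  At infinity \<open>A(x)\<close> has even and \<open>B(x) y\<close> has odd order, so the poles do not cancel, and the pole
  of \<open>B(x) y\<close> is at least as large as that of \<open>y\<close>.
\<close>
lemma ord_at_infinite_upper_bound:
  assumes "B \<noteq> 0"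
  shows "ord_at f None (to_fract A, to_fract B) \<le> - int (2 * g + 1)"
proof (rule ord_at_infinite)
  fix u v
  assume u: "has_order u (- 2)" and v: "has_order v (- int (2 * g + 1))"
    and ord: "\<And>h. ord_at f None h = zorder (\<lambda>t. ratfun_eval h (u t) (v t)) 0"
  \<comment> \<open>the order of \<open>B(u) v\<close>, written so that it is visibly odd\<close>
  define m where "m = - int (2 * (degree B + g) + 1)"
  have "has_order (\<lambda>t. poly B (u t)) (- 2 * int (degree B))"
    by (rule has_order_poly_infinite[OF u _ assms]) simp
  moreover have "- 2 * int (degree B) + (- int (2 * g + 1)) = m"
    by (simp add: m_def)
  ultimately have B: "has_order (\<lambda>t. poly B (u t) * v t) m"
    using has_order_mult[OF _ v] by metis
  have "\<exists>n\<le>m. has_order (\<lambda>t. poly A (u t) + poly B (u t) * v t) n"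
  proof (cases "A = 0")
    case True
    then show ?thesis using B by auto
  next
    case False
    have A: "has_order (\<lambda>t. poly A (u t)) (- 2 * int (degree A))"
      by (rule has_order_poly_infinite[OF u _ False]) simp
    have "- 2 * int (degree A) \<noteq> m"
      unfolding m_def by presburger
    then consider "- 2 * int (degree A) < m" | "m < - 2 * int (degree A)"
      by linarith
    then show ?thesis
    proof cases
      case 1
      then show ?thesis using has_order_add[OF A B] by (blast intro: less_imp_le)
    next
      case 2
      then show ?thesis using has_order_add[OF B A 2] by (auto simp: add.commute)
    qed
  qed
  then show ?thesis
    by (auto simp: ord ratfun_eval_def m_def dest: has_order_imp_zorder)
qed

end

section \<open>Sections of multiples of the divisor over infinity\<close>

context odd_hyperelliptic
begin

text \<open>
  In lowest terms a section is \<open>(A + B y) / d\<close>. At a root \<open>x\<close> of \<open>d\<close>, regularity at both points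
  \<open>(x, y)\<close> and \<open>(x, - y)\<close> would force \<open>A\<close> and \<open>B\<close> to vanish there as well, also when the two points
  coincide. So \<open>d\<close> is constant, and the section is \<open>A + B y\<close> with polynomials \<open>A\<close> and \<open>B\<close>. Since
  \<open>y\<close> has a pole of order \<open>2 g + 1 > 2 k\<close> at infinity, \<open>B = 0\<close>, and the pole of \<open>A(x)\<close> there has
  order \<open>2 degree A\<close>.
\<close>
lemma sections_kD:
  assumes "k \<le> g"
  shows "sections f (\<lambda>P. int k * div_D P) = {(to_fract a, 0) | a. degree a \<le> k}"
proof (intro equalityI subsetI)
  fix h assume "h \<in> {(to_fract (a :: complex poly), 0 :: complex poly fract) | a. degree a \<le> k}"
  then obtain a :: "complex poly" where h: "h = (to_fract a, 0)" "degree a \<le> k" by blast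
  show "h \<in> sections f (\<lambda>P. int k * div_D P)"
    unfolding sections_def
  proof (intro CollectI impI ballI)
    fix P assume "h \<noteq> 0" and P: "P \<in> topspace (curve f)"
    then have a: "a \<noteq> 0"
      by (auto simp: h zero_prod_def)
    show "ord_at f P h + int k * div_D P \<ge> 0"
    proof (cases P)
      case None
      then show ?thesis
        using h(2) ord_at_poly_infinite[OF a] by (simp add: h(1) div_D_def)
    next
      case (Some z)
      obtain x y where "P = Some (x, y)"
        using Some by (cases z) auto
      then show ?thesis
        using ord_at_poly_finite[OF _ a] P ram_pos[of P] by (simp add: h(1) div_D_def)
    qed
  qed
next
  fix h assume h: "h \<in> sections f (\<lambda>P. int k * div_D P)"
  obtain a b where ab: "h = (a, b)" by (cases h)
  obtain A B d where Abd: "d \<noteq> 0" "a = Fract A d" "b = Fract B d"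
      "\<And>x. poly d x = 0 \<Longrightarrow> poly A x \<noteq> 0 \<or> poly B x \<noteq> 0"
    by (rule common_denominator) blast
  show "h \<in> {(to_fract a, 0) | a. degree a \<le> k}"
  proof (cases "h = 0")
    case True
    then show ?thesis by (auto intro!: exI[of _ 0] simp: zero_prod_def)
  next
    case False
    then have ord: "ord_at f P h + int k * div_D P \<ge> 0" if "P \<in> topspace (curve f)" for P
      using h that by (simp add: sections_def)
    have no_root: "poly d x \<noteq> 0" for x
    proof
      assume x: "poly d x = 0"
      define y where "y = csqrt (poly f x)"
      have y2: "y ^ 2 = poly f x" by (simp add: y_def)
      obtain y' where y': "y' ^ 2 = poly f x"
          "poly A x + poly B x * y' \<noteq> 0 \<or> y' = 0 \<and> poly B x \<noteq> 0"
      proof (cases "poly A x + poly B x * y = 0")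
        case True
        have "poly A x + poly B x * (- y) \<noteq> 0 \<or> y = 0 \<and> poly B x \<noteq> 0"
        proof (rule ccontr)
          assume "\<not> ?thesis"
          then have "poly A x = poly B x * y" "y \<noteq> 0 \<or> poly B x = 0" by auto
          then have "poly A x = 0" "poly B x = 0" using True by auto
          then show False using Abd(4)[OF x] by simp
        qed
        then show ?thesis using that[of "- y"] y2 by auto
      qed (use that[of y] y2 in auto)
      have P: "Some (x, y') \<in> topspace (curve f)"
        using y'(1) by (simp add: topspace_curve affine_curve_def)
      show False
        using ord[OF P] ord_at_negative_pole[OF P Abd(1) x y'(2)]
        by (simp add: ab Abd div_D_def)
    qed
    then have "degree d = 0"
      using fundamental_theorem_of_algebra[of d] by (auto simp: constant_degree)
    then obtain c where c: "d = [:c:]"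
      by (rule degree_eq_zeroE)
    define A' where "A' = smult (1 / c) A"
    define B' where "B' = smult (1 / c) B"
    have "c \<noteq> 0" using Abd(1) c by auto
    then have h_eq: "h = (to_fract A', to_fract B')"
      by (simp add: ab Abd c A'_def B'_def to_fract_def eq_fract)
    have None: "None \<in> topspace (curve f)"
      by (simp add: topspace_curve)
    have "B' = 0"
    proof (rule ccontr)
      assume "B' \<noteq> 0"
      then have "ord_at f None h \<le> - int (2 * g + 1)"
        unfolding h_eq by (rule ord_at_infinite_upper_bound)
      then show False
        using ord[OF None] assms by (simp add: div_D_def)
    qed
    then have "A' \<noteq> 0"
      using False by (auto simp: h_eq zero_prod_def)
    from ord_at_poly_infinite[OF this] have "degree A' \<le> k"
      using ord[OF None] by (simp add: h_eq \<open>B' = 0\<close> div_D_def)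
    then show ?thesis
      using \<open>B' = 0\<close> by (auto simp: h_eq)
  qed
qed

text \<open>
  The monomials \<open>1, x, \<dots>, x ^ k\<close> are real sections.
\<close>
lemma span_real_sections_kD:
  assumes "k \<le> g"
  shows "ratfun.span (real_sections f (\<lambda>P. int k * div_D P)) = {(to_fract a, 0) | a. degree a \<le> k}"
    (is "ratfun.span ?V = ?S")
proof
  have "ratfun.subspace ?S"
  proof (rule ratfun.subspaceI)
    show "0 \<in> ?S"
      by (auto intro!: exI[of _ 0] simp: zero_prod_def)
    show "h + h' \<in> ?S" if h: "h \<in> ?S" "h' \<in> ?S" for h h'
    proof -
      obtain a b :: "complex poly" where "h = (to_fract a, 0)" "h' = (to_fract b, 0)"
          "degree a \<le> k" "degree b \<le> k"
        using h by blast
      then show ?thesis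
        by (auto intro!: exI[of _ "a + b"] degree_add_le)
    qed
    show "ratfun_scale c h \<in> ?S" if h: "h \<in> ?S" for c h
    proof -
      obtain a :: "complex poly" where "h = (to_fract a, 0)" "degree a \<le> k"
        using h by blast
      then show ?thesis
        by (auto intro!: exI[of _ "[:c:] * a"] order_trans[OF degree_mult_le]
            simp: ratfun_scale_def simp del: mult_pCons_left simp flip: to_fract_mult)
    qed
  qed
  moreover have "?V \<subseteq> ?S"
    using sections_kD[OF assms] by (auto simp: real_sections_def)
  ultimately show "ratfun.span ?V \<subseteq> ?S"
    by (rule ratfun.span_minimal[rotated])
next
  show "?S \<subseteq> ratfun.span ?V"
  proof
    fix h assume "h \<in> ?S"
    then obtain a where a: "h = (to_fract a, 0)" "degree a \<le> k" by blast
    have mono: "(to_fract (monom 1 i), 0) \<in> ?V" if "i \<le> k" for i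
    proof -
      have "(to_fract (monom 1 i), 0 :: complex poly fract) \<in> ?S"
        using that by (auto simp: degree_monom_eq)
      moreover have "map_poly cnj (monom 1 i) = monom 1 i"
        by (simp add: map_poly_monom)
      then have "fract_cnj (to_fract (monom 1 i)) = to_fract (monom 1 i)"
        by (simp add: fract_cnj_def flip: to_fract_def)
      moreover have "fract_cnj 0 = 0"
        by (simp add: fract_cnj_def fract_collapse)
      ultimately show ?thesis
        by (simp add: real_sections_def sections_kD[OF assms] ratfun_conj_def)
    qed
    have scale: "ratfun_scale c (to_fract b, 0) = (to_fract (smult c b), 0)" for c b
      by (simp add: ratfun_scale_def flip: to_fract_mult)
    have sum: "(\<Sum>i\<in>I. (to_fract (b i), 0 :: complex poly fract)) = (to_fract (\<Sum>i\<in>I. b i), 0)"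
      for I :: "nat set" and b :: "nat \<Rightarrow> complex poly"
      by (induction I rule: infinite_finite_induct) (auto simp: zero_prod_def)
    have "a = (\<Sum>i\<le>k. smult (coeff a i) (monom 1 i))"
      using poly_as_sum_of_monoms'[OF a(2)] by (simp add: smult_monom)
    then have "h = (\<Sum>i\<le>k. ratfun_scale (coeff a i) (to_fract (monom 1 i), 0))"
      by (simp only: scale sum a(1))
    also have "\<dots> \<in> ratfun.span ?V"
      by (intro ratfun.span_sum ratfun.span_scale ratfun.span_base mono) simp
    finally show "h \<in> ratfun.span ?V" .
  qed
qed

end

section \<open>Inflection\<close>

context odd_hyperelliptic
begin

text \<open>
  At \<open>(x, y)\<close> the orders are attained by the powers of the linear polynomial with root \<open>x\<close>, and at
  infinity, where the divisor contributes \<open>2 k\<close>, by the monomials of degree \<open>k - i\<close>.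
\<close>
lemma vanishing_orders_kD:
  assumes "k \<le> g" and P: "P \<in> topspace (curve f)"
  shows "vanishing_orders f (\<lambda>P. int k * div_D P) (real_sections f (\<lambda>P. int k * div_D P)) P
           = (\<lambda>i. ram P * int i) ` {..k}"
proof -
  have "vanishing_orders f (\<lambda>P. int k * div_D P) (real_sections f (\<lambda>P. int k * div_D P)) P
      = {ord_at f P (to_fract a, 0) + int k * div_D P | a. degree a \<le> k \<and> a \<noteq> 0}"
    unfolding vanishing_orders_def span_real_sections_kD[OF assms(1)]
    by (fastforce simp: zero_prod_def)
  also have "\<dots> = (\<lambda>i. ram P * int i) ` {..k}"
  proof (cases P)
    case None
    show ?thesis
    proof (intro equalityI subsetI)
      fix m assume "m \<in> {ord_at f P (to_fract a, 0) + int k * div_D P | a. degree a \<le> k \<and> a \<noteq> 0}"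
      then obtain a where a: "m = ord_at f P (to_fract a, 0) + int k * div_D P"
          "degree a \<le> k" "a \<noteq> 0" by blast
      then have "m = ram P * int (k - degree a)"
        by (simp add: None ord_at_poly_infinite div_D_def ram_def of_nat_diff)
      then show "m \<in> (\<lambda>i. ram P * int i) ` {..k}" by auto
    next
      fix m assume "m \<in> (\<lambda>i. ram P * int i) ` {..k}"
      then obtain i where i: "m = ram P * int i" "i \<le> k" by blast
      have "ord_at f P (to_fract (monom 1 (k - i)), 0) + int k * div_D P = m"
        using i by (simp add: None ord_at_poly_infinite degree_monom_eq div_D_def ram_def of_nat_diff)
      then show "m \<in> {ord_at f P (to_fract a, 0) + int k * div_D P | a. degree a \<le> k \<and> a \<noteq> 0}"
        by (auto intro!: exI[of _ "monom 1 (k - i)"] simp: degree_monom_eq)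
    qed
  next
    case (Some z)
    obtain x y where xy: "P = Some (x, y)"
      using Some by (cases z) auto
    have ord: "ord_at f P (to_fract a, 0) + int k * div_D P = ram P * int (order x a)" if "a \<noteq> 0" for a
      using ord_at_poly_finite[OF _ that, of x y] P by (simp add: xy div_D_def)
    show ?thesis
    proof (intro equalityI subsetI)
      fix m assume "m \<in> {ord_at f P (to_fract a, 0) + int k * div_D P | a. degree a \<le> k \<and> a \<noteq> 0}"
      then obtain a where a: "m = ram P * int (order x a)" "degree a \<le> k" "a \<noteq> 0"
        using ord by auto
      moreover have "order x a \<le> k"
        using order_degree[OF a(3), of x] a(2) by simp
      ultimately show "m \<in> (\<lambda>i. ram P * int i) ` {..k}" by auto
    next
      fix m assume "m \<in> (\<lambda>i. ram P * int i) ` {..k}"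
      then obtain i where i: "m = ram P * int i" "i \<le> k" by blast
      have "[:- x, 1:] ^ i \<noteq> 0" "degree ([:- x, 1:] ^ i) = i"
        by (auto simp: degree_linear_power)
      with i ord[of "[:- x, 1:] ^ i"]
      show "m \<in> {ord_at f P (to_fract a, 0) + int k * div_D P | a. degree a \<le> k \<and> a \<noteq> 0}"
        by (auto intro!: exI[of _ "[:- x, 1:] ^ i"] simp: order_power_n_n)
    qed
  qed
  finally show ?thesis .
qed

lemma inflectionary_weight_kD:
  assumes "k \<le> g" and "P \<in> topspace (curve f)"
  shows "inflectionary_weight f (\<lambda>P. int k * div_D P) (real_sections f (\<lambda>P. int k * div_D P)) P
           = int ((k + 1) choose 2) * (ram P - 1)"
proof -
  define os where "os = map (\<lambda>i. ram P * int i) [0..<Suc k]"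
  have "sorted os" "distinct os"
    using ram_pos[of P]
    by (auto simp: os_def sorted_map distinct_map inj_on_def sorted_wrt_iff_nth_less simp del: upt_Suc)
  moreover have "set os = (\<lambda>i. ram P * int i) ` {..k}"
    by (auto simp: os_def simp del: upt_Suc)
  ultimately have sorted: "sorted_list_of_set ((\<lambda>i. ram P * int i) ` {..k}) = os"
    by (metis sorted_list_of_set.idem_if_sorted_distinct)
  have "(\<Sum>i<length os. os ! i - int i) = (\<Sum>i\<le>k. (ram P - 1) * int i)"
    by (intro sum.cong) (auto simp: os_def algebra_simps simp del: upt_Suc)
  also have "\<dots> = (ram P - 1) * int (\<Sum>i\<le>k. i)"
    by (simp add: sum_distrib_left)
  also have "(\<Sum>i\<le>k. i) = (k + 1) choose 2"
    using gauss_sum_nat[of k] by (simp add: atMost_atLeast0 choose_two)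
  finally show ?thesis
    by (simp add: inflectionary_weight_def vanishing_orders_kD[OF assms] sorted Let_def
        mult.commute[of "ram P - 1"])
qed

theorem inflection_divisor_kD:
  assumes "k \<le> g"
  shows "inflection_divisor f (\<lambda>P. int k * div_D P) (real_sections f (\<lambda>P. int k * div_D P))
           = (\<lambda>P. int ((k + 1) choose 2) * ramification_divisor f P)"
proof
  fix P
  show "inflection_divisor f (\<lambda>P. int k * div_D P) (real_sections f (\<lambda>P. int k * div_D P)) P
          = int ((k + 1) choose 2) * ramification_divisor f P"
    using inflectionary_weight_kD[OF assms, of P] ramification_index_eq[of P]
    by (simp add: inflection_divisor_def ramification_divisor_def)
qed

lemma ramification_divisor_eq:
  "ramification_divisor f P = (if P \<in> insert None ((\<lambda>x. Some (x, 0)) ` {x. poly f x = 0}) then 1 else 0)"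
proof (cases P)
  case None
  then show ?thesis
    by (simp add: ramification_divisor_def ramification_index_eq topspace_curve ram_def)
next
  case (Some z)
  obtain x y where "P = Some (x, y)"
    using Some by (cases z) auto
  then show ?thesis
    by (auto simp: ramification_divisor_def ramification_index_eq topspace_curve affine_curve_def
        ram_def)
qed


text \<open>
  The real ramification points are the point at infinity and the points \<open>(x, 0)\<close> over the real roots
  of \<open>f\<close>. The binomial coefficient is positive for \<open>k \<ge> 1\<close>, so the inflection divisor has the same support.
\<close>
lemma num_real_inflection_points_kD:
  assumes "1 \<le> k" and "k \<le> g"
  shows "num_real_inflection_points f (\<lambda>P. int k * div_D P) (real_sections f (\<lambda>P. int k * div_D P))
           = int ((k + 1) choose 2) * int (card {x. poly f x = 0 \<and> x \<in> \<real>} + 1)"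
proof -
  let ?c = "int ((k + 1) choose 2)"
  define S where "S = insert None ((\<lambda>x. Some (x, 0 :: complex)) ` {x. poly f x = 0 \<and> x \<in> \<real>})"
  have "?c \<noteq> 0"
    using assms(1) by simp
  then have "{P \<in> real_points f. ?c * ramification_divisor f P \<noteq> 0} = S"
    by (auto simp: S_def ramification_divisor_eq real_points_def sigma_def topspace_curve
        affine_curve_def Reals_cnj_iff)
  then have "num_real_inflection_points f (\<lambda>P. int k * div_D P) (real_sections f (\<lambda>P. int k * div_D P))
      = (\<Sum>P\<in>S. ?c * ramification_divisor f P)"
    by (simp add: num_real_inflection_points_def degree_on_def inflection_divisor_kD[OF assms(2)])
  also have "\<dots> = (\<Sum>P\<in>S. ?c)"
    by (intro sum.cong) (auto simp: S_def ramification_divisor_eq)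
  also have "\<dots> = ?c * int (card S)"
    by simp
  also have "card S = card {x. poly f x = 0 \<and> x \<in> \<real>} + 1"
    unfolding S_def using poly_roots_finite[OF f_nonzero]
    by (subst card_insert_disjoint) (auto simp: card_image inj_on_def)
  finally show ?thesis .
qed

end

section \<open>Curves given by the roots of their equation\<close>

lemma rsquarefree_linear_mult:
  fixes h :: "'a::field_char_0 poly"
  assumes "rsquarefree h" and "poly h z \<noteq> 0"
  shows "rsquarefree ([:- z, 1:] * h)"
  unfolding rsquarefree_roots
proof
  fix x
  have "poly (pderiv ([:- z, 1:] * h)) x = poly h x + (x - z) * poly (pderiv h) x"
    by (subst pderiv_mult) (simp add: pderiv_pCons algebra_simps)
  then show "\<not> (poly ([:- z, 1:] * h) x = 0 \<and> poly (pderiv ([:- z, 1:] * h)) x = 0)"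
    using assms by (auto simp: rsquarefree_roots algebra_simps)
qed

lemma rsquarefree_prod_linear:
  fixes S :: "'a::field_char_0 set"
  assumes "finite S"
  shows "rsquarefree (\<Prod>z\<in>S. [:- z, 1:])"
  using assms
proof (induction S)
  case empty
  then show ?case by (simp add: rsquarefree_roots)
next
  case (insert z S)
  have "poly (\<Prod>z\<in>S. [:- z, 1:]) z \<noteq> 0"
    using insert.hyps by (auto simp: poly_prod)
  with insert show ?case
    by (simp add: rsquarefree_linear_mult del: mult_pCons_left)
qed

lemma prod_Icc_1_eq_prod_list: "(\<Prod>i = 1..m. F i) = prod_list (map F [1..<Suc m])"
  by (metis atLeastLessThanSuc_atLeastAtMost distinct_upt prod.distinct_set_conv_list set_upt)

theorem theorem3p3:
  fixes f :: "complex poly" and g n k :: nat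
    and p :: "nat \<Rightarrow> real" and q :: "nat \<Rightarrow> complex"
  assumes "genus f = g" and "g \<ge> 1"
    and "num_real_components f = n" and "n \<ge> 1" and "n \<le> g + 1"
    and "f = [:0, 1:] * (\<Prod>i = 1..2 * n - 2. [:- complex_of_real (p i), 1:])
               * (\<Prod>j = 1..g + 1 - n. [:- q j, 1:] * [:- cnj (q j), 1:])"
    and "\<And>i. i \<in> {1..2 * n - 2} \<Longrightarrow> p i \<noteq> 0"
    and "\<And>j. j \<in> {1..g + 1 - n} \<Longrightarrow> q j \<notin> \<real>"
    and "distinct ([0] @ map (\<lambda>i. complex_of_real (p i)) [1..<Suc (2 * n - 2)]
           @ map q [1..<Suc (g + 1 - n)] @ map (\<lambda>j. cnj (q j)) [1..<Suc (g + 1 - n)])"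
    and "1 \<le> k" and "k \<le> g"
  shows "let kD = (\<lambda>P. int k * div_D P); V = real_sections f kD in
      inflection_divisor f kD V = (\<lambda>P. int ((k + 1) choose 2) * ramification_divisor f P) \<and>
      num_real_inflection_points f kD V = int (k * (k + 1) * num_real_components f)"
proof -
  define real_roots where "real_roots = 0 # map (\<lambda>i. complex_of_real (p i)) [1..<Suc (2 * n - 2)]"
  define nonreal_roots where
    "nonreal_roots = map q [1..<Suc (g + 1 - n)] @ map (\<lambda>j. cnj (q j)) [1..<Suc (g + 1 - n)]"
  have distinct: "distinct (real_roots @ nonreal_roots)"
    using assms(9) by (simp add: real_roots_def nonreal_roots_def)
  have "f = (\<Prod>z\<leftarrow>real_roots @ nonreal_roots. [:- z, 1:])"
    unfolding assms(6) prod.distrib prod_Icc_1_eq_prod_list real_roots_def nonreal_roots_def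
    by (simp add: o_def mult.assoc del: upt_Suc mult_pCons_left)
  then have f: "f = (\<Prod>z\<in>set (real_roots @ nonreal_roots). [:- z, 1:])"
    using distinct by (simp only: prod.distinct_set_conv_list)
  have "degree f = card (set (real_roots @ nonreal_roots))"
    unfolding f by (subst degree_prod_sum_eq) auto
  also have "\<dots> = length (real_roots @ nonreal_roots)"
    using distinct by (rule distinct_card)
  also have "\<dots> = 2 * g + 1"
    using assms(4,5) by (simp add: real_roots_def nonreal_roots_def del: upt_Suc)
  finally interpret odd_hyperelliptic f g
    by unfold_locales (simp_all add: f rsquarefree_prod_linear del: set_append)
  have "{x. poly f x = 0 \<and> x \<in> \<real>} = set real_roots"
  proof -
    have "{x. poly f x = 0} = set real_roots \<union> set nonreal_roots"
      by (auto simp: f poly_prod)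
    moreover have "set real_roots \<subseteq> \<real>"
      by (auto simp: real_roots_def)
    moreover have "cnj (q j) \<notin> \<real>" if "j \<in> {1..g + 1 - n}" for j
      using assms(8)[OF that] by (metis Reals_cnj_iff complex_cnj_cnj)
    then have "set nonreal_roots \<inter> \<real> = {}"
      using assms(8) by (auto simp: nonreal_roots_def simp del: upt_Suc)
    ultimately show ?thesis by blast
  qed
  then have "card {x. poly f x = 0 \<and> x \<in> \<real>} + 1 = length real_roots + 1"
    using distinct distinct_card[of real_roots] by simp
  also have "\<dots> = 2 * n"
    using assms(4) by (simp add: real_roots_def del: upt_Suc)
  finally have card: "card {x. poly f x = 0 \<and> x \<in> \<real>} + 1 = 2 * n" .
  have "((k + 1) choose 2) * (2 * n) = k * (k + 1) * n"
    by (simp add: choose_two)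
  then have "num_real_inflection_points f (\<lambda>P. int k * div_D P)
      (real_sections f (\<lambda>P. int k * div_D P)) = int (k * (k + 1) * num_real_components f)"
    unfolding num_real_inflection_points_kD[OF assms(10,11)] card assms(3) by (metis of_nat_mult)
  then show ?thesis
    by (simp add: Let_def inflection_divisor_kD[OF assms(11)])
qed

end
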